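(* Let $r$ be an integer with $r>1$ and $a$ an odd integer. (1) If $a\equiv1\pmod8$ (resp. $a\equiv-1\pmod 8$), then the discriminant module of the even nondegenerate lattice with $1\times1$ Gram matrix $(2^r)$ (resp. $(-2^r)$) is isometrically isomorphic to $\underline{A}_{2^r}^a$. (2) If $a\equiv\varepsilon\cdot5\pmod8$ with $\varepsilon\in\{\pm1\}$ and $r$ is odd, let $v$ be an integer with $2^{r-1}v^2\equiv-\varepsilon\pmod5$ and set $x=\frac{2^{r-1}v^2+\varepsilon}{5}$. Then the discriminant module of the even nondegenerate lattice with Gram matrix $\begin{pmatrix}\varepsilon\cdot5\cdot2^r & 2^rv & 0\\ 2^rv & \varepsilon\cdot2x & 1\\ 0&1&2\end{pmatrix}$ is isometrically isomorphic to $\underline{A}_{2^r}^a$, and no even nondegenerate lattice of smaller rank has this property. (3) If $a\equiv\varepsilon\cdot5\pmod8$ with $\varepsilon\in\{\pm1\}$ and $r$ is even, let $v$ be an integer with $2^{r-1}v^2\equiv-1\pmod3$ and set $x=\frac{2^{r-1}v^2+1}{3}$. Then the discriminant module of the even nondegenerate lattice with Gram matrix $\begin{pmatrix}-\varepsilon\cdot3\cdot2^r & 2^rv & 0\\ 2^rv & -\varepsilon\cdot2x & 1\\ 0&1&-\varepsilon\cdot2\end{pmatrix}$ is isometrically isomorphic to $\underline{A}_{2^r}^a$, and no even nondegenerate lattice of smaller rank has this property. (4) If $a\equiv1\pmod4$ (resp. $a\equiv-1\pmod4$), then the discriminant module of the even nondegenerate lattice with $1\times1$ Gram matrix $(2)$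 (resp. $(-2)$) is isometrically isomorphic to $\underline{A}_{2}^a$.
   Context: A lattice $(L,B)$ is a free $\mathbb{Z}$-module $L$ of finite rank with a symmetric bilinear form $B\colon L\times L\to\mathbb{R}$; it is nondegenerate if its Gram matrix with respect to a basis has nonzero determinant, and even if $B(x,y)\in\mathbb{Z}$ and $B(x,x)\in2\mathbb{Z}$ for all $x,y$. The lattice with Gram matrix $G$ is $\mathbb{Z}^n$ with $B(x,y)=x^{\mathrm T}Gy$. Dual lattice $L^\sharp=\{v\in\mathbb{R}\otimes L: B(v,w)\in\mathbb{Z}\ \forall w\in L\}$; for even nondegenerate $L$ the discriminant module is $D_L=(L^\sharp/L,\ v+L\mapsto\frac12B(v,v)+\mathbb{Z})$. A finite quadratic module is a finite abelian group $M$ with $Q\colon M\to\mathbb{Q}/\mathbb{Z}$ such that $Q(nx)=n^2Q(x)$ and $B_Q(x,y)=Q(x+y)-Q(x)-Q(y)$ is bilinear and nondegenerate; an isometric isomorphism is a group isomorphism preserving $Q$. For $r\ge1$ and $a$ odd: $\underline{A}_{2^r}^a=(\mathbb{Z}/2^r\mathbb{Z},\ x+2^r\mathbb{Z}\mapsto\frac{a}{2^{r+1}}x^2+\mathbb{Z})$. *)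

theory Defs
  imports
    "HOL-Algebra.Free_Abelian_Groups"
    "HOL-Algebra.Elementary_Groups"
    "HOL-Number_Theory.Cong"
    "Jordan_Normal_Form.Determinant"
begin

section \<open>The group of reals modulo the integers\<close>

text \<open>
  The value group \<open>\<rat>/\<int>\<close> of a finite quadratic module is a subgroup of \<open>\<real>/\<int>\<close>.  The ambient group
  \<open>\<real>/\<int>\<close> is used as the type of values because bilinear forms of lattices are real-valued.
\<close>

quotient_type real_mod_int = real / "\<lambda>x y. x - y \<in> \<int>"
  morphisms rep_real_mod_int mod_int
proof (rule equivpI)
  show "reflp (\<lambda>x y::real. x - y \<in> \<int>)"
    by (simp add: reflp_def)
  show "symp (\<lambda>x y::real. x - y \<in> \<int>)"
    unfolding symp_def by (metis Ints_minus minus_diff_eq)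
  show "transp (\<lambda>x y::real. x - y \<in> \<int>)"
    unfolding transp_def by (metis Ints_add diff_add_cancel add_diff_eq)
qed

instantiation real_mod_int :: ab_group_add
begin

lift_definition zero_real_mod_int :: real_mod_int is 0 .

lift_definition plus_real_mod_int :: "real_mod_int \<Rightarrow> real_mod_int \<Rightarrow> real_mod_int" is "(+)"
proof -
  fix a b c d :: real
  assume "a - b \<in> \<int>" "c - d \<in> \<int>"
  then have "(a - b) + (c - d) \<in> \<int>" by (rule Ints_add)
  then show "a + c - (b + d) \<in> \<int>" by (simp add: algebra_simps)
qed

lift_definition uminus_real_mod_int :: "real_mod_int \<Rightarrow> real_mod_int" is "uminus"
proof -
  fix a b :: real
  assume "a - b \<in> \<int>"
  then have "- (a - b) \<in> \<int>" by (rule Ints_minus)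
  then show "- a - - b \<in> \<int>" by (simp add: algebra_simps)
qed

lift_definition minus_real_mod_int :: "real_mod_int \<Rightarrow> real_mod_int \<Rightarrow> real_mod_int" is "(-)"
proof -
  fix a b c d :: real
  assume "a - b \<in> \<int>" "c - d \<in> \<int>"
  then have "(a - b) - (c - d) \<in> \<int>" by (rule Ints_diff)
  then show "a - c - (b - d) \<in> \<int>" by (simp add: algebra_simps)
qed

instance
  by standard (transfer; simp add: algebra_simps)+

end

lift_definition int_scale :: "int \<Rightarrow> real_mod_int \<Rightarrow> real_mod_int" is "\<lambda>n x. of_int n * x"
  by (metis Ints_mult Ints_of_int right_diff_distrib)

definition rat_mod_int :: "real_mod_int set" where
  "rat_mod_int = mod_int ` \<rat>"


section \<open>Finite quadratic modules\<close>

text \<open>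
  Abelian groups, in particular \<open>\<int>\<close>-modules, are the multiplicatively written commutative groups of
  HOL-Algebra: the sum of \<open>x\<close> and \<open>y\<close> is \<open>x \<otimes> y\<close>, and \<open>n x\<close> is \<open>x [^] n\<close>.
\<close>

record 'a quadratic_module = "'a monoid" +
  quad :: "'a \<Rightarrow> real_mod_int"

definition quad_bilin :: "'a quadratic_module \<Rightarrow> 'a \<Rightarrow> 'a \<Rightarrow> real_mod_int" where
  "quad_bilin M x y = quad M (x \<otimes>\<^bsub>M\<^esub> y) - quad M x - quad M y"

definition finite_quadratic_module :: "'a quadratic_module \<Rightarrow> bool" where
  "finite_quadratic_module M \<longleftrightarrow>
     comm_group M \<and> finite (carrier M) \<and>
     quad M ` carrier M \<subseteq> rat_mod_int \<and>
     (\<forall>x\<in>carrier M. \<forall>n::int. quad M (x [^]\<^bsub>M\<^esub> n) = int_scale (n\<^sup>2) (quad M x)) \<and>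
     (\<forall>x\<in>carrier M. \<forall>y\<in>carrier M. \<forall>z\<in>carrier M.
        quad_bilin M (x \<otimes>\<^bsub>M\<^esub> y) z = quad_bilin M x z + quad_bilin M y z \<and>
        quad_bilin M z (x \<otimes>\<^bsub>M\<^esub> y) = quad_bilin M z x + quad_bilin M z y) \<and>
     (\<forall>x\<in>carrier M. (\<forall>y\<in>carrier M. quad_bilin M x y = 0) \<longrightarrow> x = \<one>\<^bsub>M\<^esub>)"

definition isometrically_isomorphic :: "'a quadratic_module \<Rightarrow> 'b quadratic_module \<Rightarrow> bool" where
  "isometrically_isomorphic M N \<longleftrightarrow>
     (\<exists>f\<in>iso M N. \<forall>x\<in>carrier M. quad N (f x) = quad M x)"

text \<open>
  The module \<open>A\<close> with parameters \<open>2\<^sup>r\<close> and \<open>a\<close>, where \<open>r \<ge> 1\<close> and \<open>a\<close> is odd.  The carrier of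
  \<^const>\<open>integer_mod_group\<close> consists of the representatives \<open>0, \<dots>, 2\<^sup>r - 1\<close>.
\<close>

definition A_module :: "nat \<Rightarrow> int \<Rightarrow> int quadratic_module" where
  "A_module r a =
     \<lparr>carrier = carrier (integer_mod_group (2 ^ r)),
      monoid.mult = monoid.mult (integer_mod_group (2 ^ r)),
      one = one (integer_mod_group (2 ^ r)),
      quad = (\<lambda>x. mod_int (of_int a / 2 ^ (r + 1) * (of_int x)\<^sup>2))\<rparr>"


section \<open>Lattices\<close>

record 'a bilinear_module = "'a monoid" +
  form :: "'a \<Rightarrow> 'a \<Rightarrow> real"

definition int_basis :: "('a, 'm) monoid_scheme \<Rightarrow> nat \<Rightarrow> (nat \<Rightarrow> 'a) \<Rightarrow> bool" where
  "int_basis L n b \<longleftrightarrow>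
     b \<in> {..<n} \<rightarrow> carrier L \<and>
     (\<forall>x\<in>carrier L. \<exists>!c::nat \<Rightarrow> int.
        c \<in> {..<n} \<rightarrow>\<^sub>E UNIV \<and> x = (\<Otimes>\<^bsub>L\<^esub>i\<in>{..<n}. b i [^]\<^bsub>L\<^esub> c i))"

definition free_of_rank :: "('a, 'm) monoid_scheme \<Rightarrow> nat \<Rightarrow> bool" where
  "free_of_rank L n \<longleftrightarrow> comm_group L \<and> (\<exists>b. int_basis L n b)"

definition is_lattice :: "'a bilinear_module \<Rightarrow> bool" where
  "is_lattice L \<longleftrightarrow>
     (\<exists>n. free_of_rank L n) \<and>
     (\<forall>x\<in>carrier L. \<forall>y\<in>carrier L. form L x y = form L y x) \<and>
     (\<forall>x\<in>carrier L. \<forall>y\<in>carrier L. \<forall>z\<in>carrier L.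
        form L (x \<otimes>\<^bsub>L\<^esub> y) z = form L x z + form L y z \<and>
        form L z (x \<otimes>\<^bsub>L\<^esub> y) = form L z x + form L z y)"

definition gram_matrix :: "'a bilinear_module \<Rightarrow> nat \<Rightarrow> (nat \<Rightarrow> 'a) \<Rightarrow> real mat" where
  "gram_matrix L n b = mat n n (\<lambda>(i, j). form L (b i) (b j))"

definition nondegenerate :: "'a bilinear_module \<Rightarrow> bool" where
  "nondegenerate L \<longleftrightarrow> (\<exists>n b. int_basis L n b \<and> det (gram_matrix L n b) \<noteq> 0)"

definition even_form :: "'a bilinear_module \<Rightarrow> bool" where
  "even_form L \<longleftrightarrow>
     (\<forall>x\<in>carrier L. \<forall>y\<in>carrier L. form L x y \<in> \<int> \<and> (\<exists>k::int. form L x x = 2 * of_int k))"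

definition even_nondegenerate_lattice :: "'a bilinear_module \<Rightarrow> bool" where
  "even_nondegenerate_lattice L \<longleftrightarrow> is_lattice L \<and> even_form L \<and> nondegenerate L"

definition gram_lattice :: "real mat \<Rightarrow> int vec bilinear_module" where
  "gram_lattice G =
     \<lparr>carrier = carrier_vec (dim_row G), monoid.mult = (+), one = 0\<^sub>v (dim_row G),
      form = (\<lambda>x y. map_vec of_int x \<bullet> (G *\<^sub>v map_vec of_int y))\<rparr>"


section \<open>Extension of scalars and the discriminant module\<close>

text \<open>
  The tensor product \<open>\<real> \<otimes> L\<close> over \<open>\<int>\<close> is the free abelian group on \<open>\<real> \<times> L\<close> modulo the relations of
  biadditivity; the relation \<open>(r n) \<otimes> x = r \<otimes> (n x)\<close> for integers \<open>n\<close> is a consequence of these.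
\<close>

definition tensor_relations :: "('a, 'm) monoid_scheme \<Rightarrow> (real \<times> 'a \<Rightarrow>\<^sub>0 int) set" where
  "tensor_relations L =
     {frag_of (r + s, x) - frag_of (r, x) - frag_of (s, x) | r s x. x \<in> carrier L} \<union>
     {frag_of (r, x \<otimes>\<^bsub>L\<^esub> y) - frag_of (r, x) - frag_of (r, y) | r x y.
        x \<in> carrier L \<and> y \<in> carrier L}"

definition tensor_kernel :: "('a, 'm) monoid_scheme \<Rightarrow> (real \<times> 'a \<Rightarrow>\<^sub>0 int) set" where
  "tensor_kernel L = generate (free_Abelian_group (UNIV \<times> carrier L)) (tensor_relations L)"

definition real_tensor :: "('a, 'm) monoid_scheme \<Rightarrow> (real \<times> 'a \<Rightarrow>\<^sub>0 int) set monoid" where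
  "real_tensor L = free_Abelian_group (UNIV \<times> carrier L) Mod tensor_kernel L"

definition pure_tensor :: "('a, 'm) monoid_scheme \<Rightarrow> real \<Rightarrow> 'a \<Rightarrow> (real \<times> 'a \<Rightarrow>\<^sub>0 int) set" where
  "pure_tensor L r x =
     tensor_kernel L #>\<^bsub>free_Abelian_group (UNIV \<times> carrier L)\<^esub> frag_of (r, x)"

text \<open>
  The form of \<open>L\<close> extends to \<open>\<real> \<otimes> L\<close> by \<open>B(r \<otimes> x, s \<otimes> y) = r s B(x, y)\<close>.  It is computed on
  representatives, and \<^const>\<open>the_elem\<close> extracts the common value.
\<close>

definition formal_form ::
    "'a bilinear_module \<Rightarrow> (real \<times> 'a \<Rightarrow>\<^sub>0 int) \<Rightarrow> (real \<times> 'a \<Rightarrow>\<^sub>0 int) \<Rightarrow> real" where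
  "formal_form L p q =
     (\<Sum>(r, x)\<in>Poly_Mapping.keys p. \<Sum>(s, y)\<in>Poly_Mapping.keys q.
        of_int (Poly_Mapping.lookup p (r, x)) * of_int (Poly_Mapping.lookup q (s, y)) *
        (r * s * form L x y))"

definition real_form ::
    "'a bilinear_module \<Rightarrow> (real \<times> 'a \<Rightarrow>\<^sub>0 int) set \<Rightarrow> (real \<times> 'a \<Rightarrow>\<^sub>0 int) set \<Rightarrow> real" where
  "real_form L v w = the_elem ((\<lambda>(p, q). formal_form L p q) ` (v \<times> w))"

definition dual_lattice :: "'a bilinear_module \<Rightarrow> (real \<times> 'a \<Rightarrow>\<^sub>0 int) set set" where
  "dual_lattice L =
     {v \<in> carrier (real_tensor L). \<forall>w\<in>carrier L. real_form L v (pure_tensor L 1 w) \<in> \<int>}"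

definition discriminant_group :: "'a bilinear_module \<Rightarrow> (real \<times> 'a \<Rightarrow>\<^sub>0 int) set set monoid" where
  "discriminant_group L =
     (real_tensor L)\<lparr>carrier := dual_lattice L\<rparr> Mod (pure_tensor L 1 ` carrier L)"

definition discriminant_module ::
    "'a bilinear_module \<Rightarrow> (real \<times> 'a \<Rightarrow>\<^sub>0 int) set set quadratic_module" where
  "discriminant_module L =
     \<lparr>carrier = carrier (discriminant_group L),
      monoid.mult = monoid.mult (discriminant_group L),
      one = one (discriminant_group L),
      quad = (\<lambda>C. the_elem ((\<lambda>v. mod_int (real_form L v v / 2)) ` C))\<rparr>"


section \<open>Well-definedness\<close>

lemma mod_int_eq_iff: "mod_int x = mod_int y \<longleftrightarrow> x - y \<in> \<int>"
  by (rule real_mod_int.abs_eq_iff)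

lemma A_module_simps [simp]:
  "carrier (A_module r a) = {0..<2 ^ r}"
  "monoid.mult (A_module r a) = (\<lambda>x y. (x + y) mod 2 ^ r)"
  "one (A_module r a) = 0"
  "quad (A_module r a) x = mod_int (of_int a / 2 ^ (r + 1) * (of_int x)\<^sup>2)"
  by (simp_all add: A_module_def carrier_integer_mod_group)

lemma A_module_quad_mod:
  assumes "r \<ge> 1"
  shows "quad (A_module r a) (x mod 2 ^ r) = quad (A_module r a) x"
proof -
  obtain s where r: "r = Suc s" using assms by (cases r) auto
  define k where "k = x div 2 ^ r"
  have x: "x = k * 2 ^ r + x mod 2 ^ r" unfolding k_def by (simp only: div_mult_mod_eq)
  define y where "y = x mod 2 ^ r"
  have "(of_int a / 2 ^ (r + 1) * (of_int y)\<^sup>2 - of_int a / 2 ^ (r + 1) * (of_int x)\<^sup>2 :: real)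
      = of_int (- a * (k\<^sup>2 * 2 ^ s + k * y))"
    unfolding x[folded y_def] r by (simp add: power2_eq_square field_simps)
  then show ?thesis
    unfolding A_module_simps y_def[symmetric] mod_int_eq_iff by (metis Ints_of_int)
qed

lemma A_module_quad_bilin:
  assumes "r \<ge> 1"
  shows "quad_bilin (A_module r a) x y = mod_int (of_int (a * x * y) / 2 ^ r)"
proof -
  have "quad (A_module r a) ((x + y) mod 2 ^ r) - quad (A_module r a) x - quad (A_module r a) y =
        mod_int (of_int a / 2 ^ (r + 1) * (of_int (x + y))\<^sup>2 - of_int a / 2 ^ (r + 1) * (of_int x)\<^sup>2
                 - of_int a / 2 ^ (r + 1) * (of_int y)\<^sup>2)"
    unfolding A_module_quad_mod[OF assms] by (simp add: minus_real_mod_int.abs_eq)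
  also have "\<dots> = mod_int (of_int (a * x * y) / 2 ^ r)"
    by (rule arg_cong[of _ _ mod_int]) (simp add: power2_eq_square field_simps)
  finally show ?thesis by (simp add: quad_bilin_def)
qed

lemma finite_quadratic_module_A_module:
  assumes "r \<ge> 1" "odd a"
  shows "finite_quadratic_module (A_module r a)"
proof -
  let ?A = "A_module r a"
  have pow: "x [^]\<^bsub>?A\<^esub> n = (n * x) mod 2 ^ r" if "x \<in> carrier ?A" for x and n :: int
  proof -
    have "x [^]\<^bsub>?A\<^esub> n = x [^]\<^bsub>integer_mod_group (2 ^ r)\<^esub> n"
      by (simp add: A_module_def int_pow_def nat_pow_def m_inv_def Let_def)
    then show ?thesis by (simp add: int_pow_integer_mod_group)
  qed
  have "comm_group ?A"
  proof (rule comm_groupI)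
    fix x assume "x \<in> carrier ?A"
    then show "\<exists>y\<in>carrier ?A. y \<otimes>\<^bsub>?A\<^esub> x = \<one>\<^bsub>?A\<^esub>"
      by (intro bexI[of _ "(- x) mod 2 ^ r"]) (simp_all add: mod_add_left_eq)
  qed (simp_all add: mod_simps add.commute add.left_commute)
  moreover have "quad ?A ` carrier ?A \<subseteq> rat_mod_int"
    by (auto simp: rat_mod_int_def)
  moreover have "quad ?A (x [^]\<^bsub>?A\<^esub> n) = int_scale (n\<^sup>2) (quad ?A x)"
    if "x \<in> carrier ?A" for x and n :: int
    unfolding pow[OF that] A_module_quad_mod[OF assms(1)]
    by (simp add: int_scale.abs_eq power_mult_distrib mult_ac)
  moreover have "quad_bilin ?A (x \<otimes>\<^bsub>?A\<^esub> y) z = quad_bilin ?A x z + quad_bilin ?A y z \<and>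
        quad_bilin ?A z (x \<otimes>\<^bsub>?A\<^esub> y) = quad_bilin ?A z x + quad_bilin ?A z y" for x y z
  proof -
    define k where "k = (x + y) div 2 ^ r"
    have k: "(x + y) mod 2 ^ r = x + y - k * 2 ^ r"
      unfolding k_def by (simp add: minus_div_mult_eq_mod)
    have "(of_int (a * (x + y - k * 2 ^ r) * z) / 2 ^ r - (of_int (a * x * z) / 2 ^ r + of_int (a * y * z) / 2 ^ r) :: real)
       = of_int (- a * k * z)"
      by (simp add: field_simps)
    then have *: "mod_int (of_int (a * (x + y - k * 2 ^ r) * z) / 2 ^ r) =
         mod_int (of_int (a * x * z) / 2 ^ r + of_int (a * y * z) / 2 ^ r)"
      unfolding mod_int_eq_iff by (metis Ints_of_int)
    then have "mod_int (of_int (a * z * (x + y - k * 2 ^ r)) / 2 ^ r) =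
         mod_int (of_int (a * z * x) / 2 ^ r + of_int (a * z * y) / 2 ^ r)"
      by (simp only: mult_ac)
    with * show ?thesis
      unfolding A_module_quad_bilin[OF assms(1)] A_module_simps k
      by (simp only: plus_real_mod_int.abs_eq)
  qed
  moreover have "x = \<one>\<^bsub>?A\<^esub>" if x: "x \<in> carrier ?A" and "\<forall>y\<in>carrier ?A. quad_bilin ?A x y = 0" for x
  proof -
    have "1 \<in> carrier ?A" using assms(1) by (simp add: one_less_power)
    with that have "mod_int (of_int (a * x * 1) / 2 ^ r) = mod_int 0"
      unfolding A_module_quad_bilin[OF assms(1)] zero_real_mod_int.abs_eq[symmetric] by blast
    then obtain k :: int where "of_int (a * x) / 2 ^ r = (of_int k :: real)"
      unfolding mod_int_eq_iff by (auto elim: Ints_cases)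
    then have "(of_int (a * x) :: real) = of_int (k * 2 ^ r)"
      by (simp add: field_simps)
    then have "a * x = k * 2 ^ r" by (simp only: of_int_eq_iff)
    then have "2 ^ r dvd a * x" by simp
    moreover have "coprime (2 ^ r) a" using assms(2) by simp
    ultimately have "2 ^ r dvd x" by (simp add: coprime_dvd_mult_right_iff)
    then have "x mod 2 ^ r = 0" by (rule dvd_imp_mod_0)
    with x show ?thesis by (simp add: mod_pos_pos_trivial)
  qed
  ultimately show ?thesis
    unfolding finite_quadratic_module_def by simp
qed

lemma finite_quadratic_module_isometric:
  assumes "isometrically_isomorphic M N" "group M" "finite_quadratic_module N"
  shows "finite_quadratic_module M"
proof -
  obtain f where f: "f \<in> iso M N" and q: "\<And>x. x \<in> carrier M \<Longrightarrow> quad N (f x) = quad M x"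
    using assms(1) unfolding isometrically_isomorphic_def by blast
  note N = assms(3)[unfolded finite_quadratic_module_def]
  interpret M: group M by fact
  interpret N: comm_group N using N by (rule conjunct1)
  interpret h: group_hom M N f
    using f by unfold_locales (simp add: iso_def)
  have bij: "bij_betw f (carrier M) (carrier N)" using f by (simp add: iso_def)
  then have inj: "inj_on f (carrier M)" and im: "f ` carrier M = carrier N"
    by (auto simp: bij_betw_def)
  have comm: "comm_group M"
  proof (rule M.group_comm_groupI)
    fix x y assume "x \<in> carrier M" "y \<in> carrier M"
    then show "x \<otimes>\<^bsub>M\<^esub> y = y \<otimes>\<^bsub>M\<^esub> x"
      by (intro inj_onD[OF inj]) (auto simp: N.m_comm)
  qed
  have fin: "finite (carrier N)" and rat: "quad N ` carrier N \<subseteq> rat_mod_int"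
    and pow_all: "\<forall>x\<in>carrier N. \<forall>n::int. quad N (x [^]\<^bsub>N\<^esub> n) = int_scale (n\<^sup>2) (quad N x)"
    and nondeg: "\<forall>x\<in>carrier N. (\<forall>y\<in>carrier N. quad_bilin N x y = 0) \<longrightarrow> x = \<one>\<^bsub>N\<^esub>"
    by (rule N[THEN conjunct2, THEN conjunct1]
        N[THEN conjunct2, THEN conjunct2, THEN conjunct1]
        N[THEN conjunct2, THEN conjunct2, THEN conjunct2, THEN conjunct1]
        N[THEN conjunct2, THEN conjunct2, THEN conjunct2, THEN conjunct2, THEN conjunct2])+
  have quad_pow: "quad N (x [^]\<^bsub>N\<^esub> n) = int_scale (n\<^sup>2) (quad N x)"
    if "x \<in> carrier N" for x and n :: int using pow_all that by blast
  have bilin: "quad_bilin N (x \<otimes>\<^bsub>N\<^esub> y) z = quad_bilin N x z + quad_bilin N y z"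
       "quad_bilin N z (x \<otimes>\<^bsub>N\<^esub> y) = quad_bilin N z x + quad_bilin N z y"
    if "x \<in> carrier N" "y \<in> carrier N" "z \<in> carrier N" for x y z
    using N[THEN conjunct2, THEN conjunct2, THEN conjunct2, THEN conjunct2, THEN conjunct1] that
    by blast+
  have b: "quad_bilin M x y = quad_bilin N (f x) (f y)" if "x \<in> carrier M" "y \<in> carrier M" for x y
    unfolding quad_bilin_def h.hom_mult[OF that, symmetric] using that by (simp add: q del: h.hom_mult)
  show ?thesis
    unfolding finite_quadratic_module_def
  proof (intro conjI ballI allI impI)
    show "finite (carrier M)" using fin bij_betw_finite[OF bij] by simp
    have "quad M ` carrier M = quad N ` carrier N"
      unfolding im[symmetric] image_image using q by (intro image_cong) simp_all
    then show "quad M ` carrier M \<subseteq> rat_mod_int" using rat by simp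
  next
    fix x and n :: int assume x: "x \<in> carrier M"
    have "quad M (x [^]\<^bsub>M\<^esub> n) = quad N (f x [^]\<^bsub>N\<^esub> n)"
      unfolding h.hom_int_pow[OF x, symmetric] using x by (simp add: q)
    then show "quad M (x [^]\<^bsub>M\<^esub> n) = int_scale (n\<^sup>2) (quad M x)"
      using x by (simp add: q quad_pow)
  next
    fix x assume x: "x \<in> carrier M" and "\<forall>y\<in>carrier M. quad_bilin M x y = 0"
    then have "\<forall>y\<in>carrier N. quad_bilin N (f x) y = 0"
      unfolding im[symmetric] by (simp add: b)
    then have "f x = \<one>\<^bsub>N\<^esub>" using nondeg h.hom_closed[OF x] by blast
    then show "x = \<one>\<^bsub>M\<^esub>" using x by (intro inj_onD[OF inj]) simp_all
  qed (simp_all add: b bilin comm)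
qed

lemma formal_form_alt:
  "formal_form L p q =
     (\<Sum>u\<in>Poly_Mapping.keys p. of_int (Poly_Mapping.lookup p u) *
       (\<Sum>w\<in>Poly_Mapping.keys q. of_int (Poly_Mapping.lookup q w) *
          (fst u * fst w * form L (snd u) (snd w))))"
  by (simp add: formal_form_def case_prod_unfold sum_distrib_left mult_ac)

lemma formal_form_add_left: "formal_form L (p + p') q = formal_form L p q + formal_form L p' q"
proof -
  define S where "S = Poly_Mapping.keys p \<union> Poly_Mapping.keys p'"
  define g where "g u = (\<Sum>w\<in>Poly_Mapping.keys q. of_int (Poly_Mapping.lookup q w) *
          (fst u * fst w * form L (snd u) (snd w)))" for u
  have *: "formal_form L t q = (\<Sum>u\<in>S. of_int (Poly_Mapping.lookup t u) * g u)"
    if "Poly_Mapping.keys t \<subseteq> S" for t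
    unfolding formal_form_alt g_def[symmetric]
    by (rule sum.mono_neutral_left) (use that in \<open>auto simp: S_def in_keys_iff\<close>)
  have "Poly_Mapping.keys (p + p') \<subseteq> S" unfolding S_def by (rule Poly_Mapping.keys_add)
  then show ?thesis
    by (simp add: * S_def lookup_add distrib_right sum.distrib)
qed

lemma formal_form_add_right: "formal_form L p (q + q') = formal_form L p q + formal_form L p q'"
proof -
  define S where "S = Poly_Mapping.keys q \<union> Poly_Mapping.keys q'"
  have *: "formal_form L p t = (\<Sum>u\<in>Poly_Mapping.keys p. of_int (Poly_Mapping.lookup p u) *
       (\<Sum>w\<in>S. of_int (Poly_Mapping.lookup t w) * (fst u * fst w * form L (snd u) (snd w))))"
    if "Poly_Mapping.keys t \<subseteq> S" for t
    unfolding formal_form_alt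
    by (intro sum.cong refl arg_cong[of _ _ "(*) _"] sum.mono_neutral_left)
       (use that in \<open>auto simp: S_def in_keys_iff\<close>)
  have "Poly_Mapping.keys (q + q') \<subseteq> S" unfolding S_def by (rule Poly_Mapping.keys_add)
  then show ?thesis
    by (simp add: * S_def lookup_add distrib_right distrib_left sum.distrib)
qed

lemma formal_form_diff_left: "formal_form L (p - p') q = formal_form L p q - formal_form L p' q"
  using formal_form_add_left[of L "p - p'" p' q] by simp

lemma formal_form_diff_right: "formal_form L p (q - q') = formal_form L p q - formal_form L p q'"
  using formal_form_add_right[of L p "q - q'" q'] by simp

lemma formal_form_frag_of: "formal_form L (frag_of (r, x)) (frag_of (s, y)) = r * s * form L x y"
  by (simp add: formal_form_def)

lemma formal_form_zero [simp]: "formal_form L 0 q = 0" "formal_form L p 0 = 0"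
  by (simp_all add: formal_form_def)

lemma formal_form_eq_0_frag:
  assumes "\<And>r x. x \<in> C \<Longrightarrow> formal_form L p (frag_of (r, x)) = 0"
    and "Poly_Mapping.keys q \<subseteq> UNIV \<times> C"
  shows "formal_form L p q = 0"
  using assms(2)
  by (induction q rule: frag_induction) (auto simp: assms(1) formal_form_diff_right)

lemma formal_form_eq_0_frag':
  assumes "\<And>r x. x \<in> C \<Longrightarrow> formal_form L (frag_of (r, x)) q = 0"
    and "Poly_Mapping.keys p \<subseteq> UNIV \<times> C"
  shows "formal_form L p q = 0"
  using assms(2)
  by (induction p rule: frag_induction) (auto simp: assms(1) formal_form_diff_left)

lemma tensor_relations_subset:
  assumes "comm_group L"
  shows "tensor_relations L \<subseteq> carrier (free_Abelian_group (UNIV \<times> carrier L))"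
proof -
  interpret comm_group L by fact
  have fo: "frag_of (r, x) \<in> carrier (free_Abelian_group (UNIV \<times> carrier L))"
    if "x \<in> carrier L" for r :: real and x using that by (simp add: free_Abelian_group_def)
  have "p - q \<in> carrier (free_Abelian_group (UNIV \<times> carrier L))"
    if "p \<in> carrier (free_Abelian_group (UNIV \<times> carrier L))" "q \<in> carrier (free_Abelian_group (UNIV \<times> carrier L))"
    for p q :: "real \<times> 'a \<Rightarrow>\<^sub>0 int"
    using that keys_diff[of p q] by (auto simp: free_Abelian_group_def)
  then show ?thesis
    unfolding tensor_relations_def using fo by auto
qed

lemma formal_form_tensor_kernel:
  assumes "is_lattice L" "k \<in> tensor_kernel L" "Poly_Mapping.keys q \<subseteq> UNIV \<times> carrier L"
  shows "formal_form L k q = 0 \<and> formal_form L q k = 0"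
proof -
  have L: "comm_group L" using assms(1) by (auto simp: is_lattice_def free_of_rank_def)
  then interpret comm_group L .
  let ?F = "free_Abelian_group (UNIV \<times> carrier L)"
  have B: "form L (x \<otimes>\<^bsub>L\<^esub> y) z = form L x z + form L y z"
       "form L z (x \<otimes>\<^bsub>L\<^esub> y) = form L z x + form L z y"
    if "x \<in> carrier L" "y \<in> carrier L" "z \<in> carrier L" for x y z
    using assms(1) that unfolding is_lattice_def by blast+
  have rel: "formal_form L h q = 0 \<and> formal_form L q h = 0" if "h \<in> tensor_relations L" for h
    using that unfolding tensor_relations_def
    by (auto intro!: formal_form_eq_0_frag[OF _ assms(3)] formal_form_eq_0_frag'[OF _ assms(3)]
          simp: formal_form_diff_left formal_form_diff_right formal_form_frag_of B ring_distribs)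
  from assms(2)[unfolded tensor_kernel_def] show ?thesis
  proof induction
    case one
    then show ?case by simp
  next
    case (incl h)
    then show ?case using rel by blast
  next
    case (inv h)
    then have "h \<in> carrier ?F" using tensor_relations_subset[OF L] by blast
    then have "Poly_Mapping.keys h \<subseteq> UNIV \<times> carrier L" by (simp add: free_Abelian_group_def)
    then have "inv\<^bsub>?F\<^esub> h = 0 - h" by simp
    then show ?case
      using rel[OF inv] by (simp add: formal_form_diff_left formal_form_diff_right del: diff_0)
  next
    case (eng h1 h2)
    then show ?case by (simp add: formal_form_add_left formal_form_add_right)
  qed
qed

lemma real_form_coset:
  assumes "is_lattice L"
    and "Poly_Mapping.keys p \<subseteq> UNIV \<times> carrier L" "Poly_Mapping.keys q \<subseteq> UNIV \<times> carrier L"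
  shows "real_form L (tensor_kernel L #>\<^bsub>free_Abelian_group (UNIV \<times> carrier L)\<^esub> p)
                     (tensor_kernel L #>\<^bsub>free_Abelian_group (UNIV \<times> carrier L)\<^esub> q)
         = formal_form L p q"
proof -
  have L: "comm_group L" using assms(1) by (auto simp: is_lattice_def free_of_rank_def)
  let ?F = "free_Abelian_group (UNIV \<times> carrier L) :: (real \<times> 'a \<Rightarrow>\<^sub>0 int) monoid"
  interpret F: group ?F by simp
  have K: "Poly_Mapping.keys k \<subseteq> UNIV \<times> carrier L" if "k \<in> tensor_kernel L" for k
    using F.generate_incl[OF tensor_relations_subset[OF L]] that
    unfolding tensor_kernel_def by (auto simp: free_Abelian_group_def)
  have coset: "tensor_kernel L #>\<^bsub>?F\<^esub> t = (\<lambda>k. k + t) ` tensor_kernel L" for t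
    by (auto simp: r_coset_def)
  have "0 \<in> tensor_kernel L"
    unfolding tensor_kernel_def using generate.one[of ?F] by simp
  then have ne: "(tensor_kernel L #>\<^bsub>?F\<^esub> p) \<times> (tensor_kernel L #>\<^bsub>?F\<^esub> q) \<noteq> {}"
    unfolding coset by blast
  have "formal_form L (k + p) (k' + q) = formal_form L p q"
    if "k \<in> tensor_kernel L" "k' \<in> tensor_kernel L" for k k'
  proof -
    have "formal_form L k k' = 0" "formal_form L k q = 0" "formal_form L p k' = 0"
      using formal_form_tensor_kernel[OF assms(1)] that assms(2,3) K[OF that(2)] by blast+
    then show ?thesis by (simp add: formal_form_add_left formal_form_add_right)
  qed
  then have "formal_form L p' q' = formal_form L p q"
    if "p' \<in> tensor_kernel L #>\<^bsub>?F\<^esub> p" "q' \<in> tensor_kernel L #>\<^bsub>?F\<^esub> q" for p' q'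
    using that unfolding coset by blast
  then have "(\<lambda>(p, q). formal_form L p q) `
      ((tensor_kernel L #>\<^bsub>?F\<^esub> p) \<times> (tensor_kernel L #>\<^bsub>?F\<^esub> q)) =
      (\<lambda>_. formal_form L p q) ` ((tensor_kernel L #>\<^bsub>?F\<^esub> p) \<times> (tensor_kernel L #>\<^bsub>?F\<^esub> q))"
    by (intro image_cong) auto
  also have "\<dots> = {formal_form L p q}"
    using ne by (rule image_constant_conv[THEN trans, OF if_not_P])
  finally have "(\<lambda>(p, q). formal_form L p q) `
      ((tensor_kernel L #>\<^bsub>?F\<^esub> p) \<times> (tensor_kernel L #>\<^bsub>?F\<^esub> q)) = {formal_form L p q}" .
  then show ?thesis by (simp add: real_form_def)
qed

lemma real_form_pure_tensor:
  assumes "is_lattice L" "x \<in> carrier L" "y \<in> carrier L"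
  shows "real_form L (pure_tensor L r x) (pure_tensor L s y) = r * s * form L x y"
  unfolding pure_tensor_def using assms by (subst real_form_coset) (auto simp: formal_form_frag_of)

end

theory Submission
  imports Defs
begin

text \<open>
  In coordinates with respect to a basis, \<open>D\<^sub>L\<close> is \<open>{t \<in> \<real>\<^sup>n. G t \<in> \<int>\<^sup>n} / \<int>\<^sup>n\<close>, and it is isometric to \<open>A\<close> iff it
  is generated by a class \<open>w\<close> of order \<open>2\<^sup>r\<close> with \<open>B(w, w) / 2 = a / 2\<^sup>r\<^sup>+\<^sup>1\<close> modulo \<open>\<int>\<close>.  For the matrices of the
  theorem the dual lattice is \<open>2\<^sup>-\<^sup>r \<int> \<times> \<int>\<^sup>n\<^sup>-\<^sup>1\<close> and the first diagonal entry is \<open>2\<^sup>r u\<close> with \<open>u \<equiv> a\<close> modulo \<open>8\<close>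
  (modulo \<open>4\<close> if \<open>r = 1\<close>); as \<open>a / u\<close> is then a square \<open>s\<^sup>2\<close> modulo \<open>2\<^sup>r\<^sup>+\<^sup>1\<close>, the vector
  \<open>w = (s / 2\<^sup>r, 0, 0)\<close> does it.  Conversely, a lattice of rank one must have Gram matrix \<open>(\<plusminus>2\<^sup>r)\<close>, which forces
  \<open>a \<equiv> \<plusminus>1\<close> modulo \<open>8\<close>, and an even lattice of rank two never has exactly one element of order two in
  its discriminant group.
\<close>

section \<open>Extension of scalars\<close>

lemma subgroup_tensor_kernel:
  assumes "comm_group L"
  shows "subgroup (tensor_kernel L) (free_Abelian_group (UNIV \<times> carrier L))"
  unfolding tensor_kernel_def
  by (rule group.generate_is_subgroup[OF group_free_Abelian_group tensor_relations_subset[OF assms]])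

lemma comm_group_real_tensor:
  assumes "comm_group L"
  shows "comm_group (real_tensor L)"
  unfolding real_tensor_def
  by (rule comm_group.abelian_FactGroup[OF abelian_free_Abelian_group subgroup_tensor_kernel[OF assms]])

lemma carrier_real_tensor:
  "carrier (real_tensor L) =
     (\<lambda>p. tensor_kernel L #>\<^bsub>free_Abelian_group (UNIV \<times> carrier L)\<^esub> p) `
       {p. Poly_Mapping.keys p \<subseteq> UNIV \<times> carrier L}"
  unfolding real_tensor_def carrier_FactGroup by (rule image_cong) auto

lemma mult_real_tensor_coset:
  assumes "comm_group L"
    and "Poly_Mapping.keys p \<subseteq> UNIV \<times> carrier L" "Poly_Mapping.keys q \<subseteq> UNIV \<times> carrier L"
  shows "(tensor_kernel L #>\<^bsub>free_Abelian_group (UNIV \<times> carrier L)\<^esub> p) \<otimes>\<^bsub>real_tensor L\<^esub>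
         (tensor_kernel L #>\<^bsub>free_Abelian_group (UNIV \<times> carrier L)\<^esub> q)
       = tensor_kernel L #>\<^bsub>free_Abelian_group (UNIV \<times> carrier L)\<^esub> (p + q)"
proof -
  have "tensor_kernel L \<lhd> free_Abelian_group (UNIV \<times> carrier L)"
    by (rule comm_group.subgroup_imp_normal[OF abelian_free_Abelian_group subgroup_tensor_kernel[OF assms(1)]])
  from normal.rcos_sum[OF this, of p q] assms(2,3) show ?thesis
    by (simp add: real_tensor_def)
qed

lemma tensor_coset_eqI:
  assumes "comm_group L" "p - q \<in> tensor_kernel L" "Poly_Mapping.keys q \<subseteq> UNIV \<times> carrier L"
  shows "tensor_kernel L #>\<^bsub>free_Abelian_group (UNIV \<times> carrier L)\<^esub> p
       = tensor_kernel L #>\<^bsub>free_Abelian_group (UNIV \<times> carrier L)\<^esub> q"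
proof -
  have "p = (p - q) + q" by simp
  then have "p \<in> tensor_kernel L #>\<^bsub>free_Abelian_group (UNIV \<times> carrier L)\<^esub> q"
    unfolding r_coset_def using assms(2) by fastforce
  then show ?thesis
    using group.repr_independence[OF group_free_Abelian_group _ _ subgroup_tensor_kernel[OF assms(1)]]
      assms(3) by auto
qed

lemma tensor_relations_subset_kernel: "tensor_relations L \<subseteq> tensor_kernel L"
  unfolding tensor_kernel_def by (auto intro: generate.incl)

section \<open>Biadditivity of pure tensors and the action of integers\<close>

lemma pure_tensor_closed: "x \<in> carrier L \<Longrightarrow> pure_tensor L r x \<in> carrier (real_tensor L)"
  unfolding carrier_real_tensor pure_tensor_def by (rule imageI) simp

lemma pure_tensor_add_left:
  assumes "comm_group L" "x \<in> carrier L"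
  shows "pure_tensor L (r + s) x = pure_tensor L r x \<otimes>\<^bsub>real_tensor L\<^esub> pure_tensor L s x"
proof -
  have "frag_of (r + s, x) - (frag_of (r, x) + frag_of (s, x)) \<in> tensor_kernel L"
    using assms(2) tensor_relations_subset_kernel[of L]
    unfolding tensor_relations_def diff_diff_eq by blast
  then show ?thesis
    unfolding pure_tensor_def using assms keys_add[of "frag_of (r, x)" "frag_of (s, x)"]
    by (simp add: mult_real_tensor_coset) (rule tensor_coset_eqI, auto)
qed

lemma pure_tensor_mult_right:
  assumes "comm_group L" "x \<in> carrier L" "y \<in> carrier L"
  shows "pure_tensor L r (x \<otimes>\<^bsub>L\<^esub> y) = pure_tensor L r x \<otimes>\<^bsub>real_tensor L\<^esub> pure_tensor L r y"
proof -
  have "frag_of (r, x \<otimes>\<^bsub>L\<^esub> y) - (frag_of (r, x) + frag_of (r, y)) \<in> tensor_kernel L"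
    using assms(2,3) tensor_relations_subset_kernel[of L]
    unfolding tensor_relations_def diff_diff_eq by blast
  then show ?thesis
    unfolding pure_tensor_def using assms keys_add[of "frag_of (r, x)" "frag_of (r, y)"]
    by (simp add: mult_real_tensor_coset) (rule tensor_coset_eqI, auto)
qed

lemma pure_tensor_hom:
  assumes "comm_group L"
  shows "pure_tensor L r \<in> hom L (real_tensor L)"
  using assms by (auto intro!: homI simp: pure_tensor_closed pure_tensor_mult_right)

lemma group_hom_pure_tensor:
  assumes "comm_group L"
  shows "group_hom L (real_tensor L) (pure_tensor L r)"
  using assms comm_group_real_tensor[OF assms] pure_tensor_hom[OF assms]
  by (simp add: group_hom_def group_hom_axioms_def comm_group_def)

lemma pure_tensor_zero:
  assumes "comm_group L" "x \<in> carrier L"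
  shows "pure_tensor L 0 x = \<one>\<^bsub>real_tensor L\<^esub>"
proof -
  interpret R: comm_group "real_tensor L" by (rule comm_group_real_tensor[OF assms(1)])
  show ?thesis
    using pure_tensor_add_left[OF assms, of 0 0] pure_tensor_closed[OF assms(2)]
    by (simp add: R.l_cancel_one')
qed

text \<open>Moving an integer across the tensor sign follows from biadditivity: induction gives
  natural multiples, inverses give negative ones, and the homomorphism
  \<open>pure_tensor L r\<close> carries powers of \<open>x\<close> to powers of its tensor.\<close>

lemma pure_tensor_int_pow:
  assumes "comm_group L" "x \<in> carrier L"
  shows "pure_tensor L r (x [^]\<^bsub>L\<^esub> (k::int)) = pure_tensor L (of_int k * r) x"
proof -
  interpret R: comm_group "real_tensor L" by (rule comm_group_real_tensor[OF assms(1)])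
  interpret h: group_hom L "real_tensor L" "pure_tensor L r" by (rule group_hom_pure_tensor[OF assms(1)])
  note c = pure_tensor_closed[OF assms(2)]
  have nat: "pure_tensor L (of_nat m * s) x = pure_tensor L s x [^]\<^bsub>real_tensor L\<^esub> m" for m s
    by (induction m)
      (simp_all add: pure_tensor_zero[OF assms] distrib_right pure_tensor_add_left[OF assms] R.m_comm c)
  have minus: "pure_tensor L (- s) x = inv\<^bsub>real_tensor L\<^esub> pure_tensor L s x" for s
    using pure_tensor_add_left[OF assms, of "- s" s]
    by (simp add: pure_tensor_zero[OF assms] c R.inv_equality)
  have "pure_tensor L (of_int k * r) x = pure_tensor L r x [^]\<^bsub>real_tensor L\<^esub> k"
  proof (cases k)
    case (nonneg m)
    then show ?thesis by (simp add: nat int_pow_int)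
  next
    case (neg m)
    have "pure_tensor L (of_int k * r) x = pure_tensor L (- (of_nat (Suc m) * r)) x"
      unfolding neg by (simp add: algebra_simps)
    also have "\<dots> = pure_tensor L r x [^]\<^bsub>real_tensor L\<^esub> k"
      unfolding minus nat neg
      by (simp add: R.int_pow_neg c int_pow_int del: of_nat_Suc)
    finally show ?thesis .
  qed
  then show ?thesis using h.hom_int_pow[OF assms(2)] by simp
qed

section \<open>Additivity of the extended form\<close>

lemma real_form_mult:
  assumes "is_lattice L" "u \<in> carrier (real_tensor L)" "v \<in> carrier (real_tensor L)"
    "w \<in> carrier (real_tensor L)"
  shows "real_form L (u \<otimes>\<^bsub>real_tensor L\<^esub> v) w = real_form L u w + real_form L v w"
    and "real_form L w (u \<otimes>\<^bsub>real_tensor L\<^esub> v) = real_form L w u + real_form L w v"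
proof -
  have L: "comm_group L" using assms(1) by (auto simp: is_lattice_def free_of_rank_def)
  obtain p q s where pqs: "Poly_Mapping.keys p \<subseteq> UNIV \<times> carrier L" "Poly_Mapping.keys q \<subseteq> UNIV \<times> carrier L"
      "Poly_Mapping.keys s \<subseteq> UNIV \<times> carrier L"
    and uvw: "u = tensor_kernel L #>\<^bsub>free_Abelian_group (UNIV \<times> carrier L)\<^esub> p"
      "v = tensor_kernel L #>\<^bsub>free_Abelian_group (UNIV \<times> carrier L)\<^esub> q"
      "w = tensor_kernel L #>\<^bsub>free_Abelian_group (UNIV \<times> carrier L)\<^esub> s"
    using assms(2-4) unfolding carrier_real_tensor by auto
  have "Poly_Mapping.keys (p + q) \<subseteq> UNIV \<times> carrier L"
    using keys_add[of p q] pqs by blast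
  then show "real_form L (u \<otimes>\<^bsub>real_tensor L\<^esub> v) w = real_form L u w + real_form L v w"
    and "real_form L w (u \<otimes>\<^bsub>real_tensor L\<^esub> v) = real_form L w u + real_form L w v"
    unfolding uvw using pqs assms(1)
    by (simp_all add: mult_real_tensor_coset[OF L] real_form_coset formal_form_add_left formal_form_add_right)
qed

text \<open>Passes from products in a multiplicatively written group to sums in a type of class
  \<open>ab_group_add\<close>. It serves for the extended form in each argument and later for single
  coordinates of integer vectors.\<close>

lemma additive_finprod:
  fixes \<phi> :: "'a \<Rightarrow> 'b::ab_group_add"
  assumes "comm_group G" "\<And>x y. x \<in> carrier G \<Longrightarrow> y \<in> carrier G \<Longrightarrow> \<phi> (x \<otimes>\<^bsub>G\<^esub> y) = \<phi> x + \<phi> y"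
    and "finite I" "f \<in> I \<rightarrow> carrier G"
  shows "\<phi> (finprod G f I) = (\<Sum>i\<in>I. \<phi> (f i))"
proof -
  interpret comm_group G by fact
  have one: "\<phi> \<one>\<^bsub>G\<^esub> = 0" using assms(2)[of "\<one>\<^bsub>G\<^esub>" "\<one>\<^bsub>G\<^esub>"] by simp
  from assms(3,4) show ?thesis
    by (induction I rule: finite_induct) (simp_all add: one assms(2))
qed

section \<open>Coordinates with respect to a basis\<close>

lemma hom_finprod:
  assumes "comm_group G" "comm_group H" "h \<in> hom G H" "finite I" "f \<in> I \<rightarrow> carrier G"
  shows "h (finprod G f I) = finprod H (\<lambda>i. h (f i)) I"
proof -
  interpret G: comm_group G by fact
  interpret H: comm_group H by fact
  interpret group_hom G H h by unfold_locales fact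
  from assms(4,5) show ?thesis
    by (induction I rule: finite_induct) (simp_all add: Pi_def)
qed

locale based_lattice =
  fixes L :: "'a bilinear_module" and n :: nat and b :: "nat \<Rightarrow> 'a"
  assumes lattice: "is_lattice L" and basis: "int_basis L n b"
begin

lemma comm_group_lattice: "comm_group L"
  using lattice by (auto simp: is_lattice_def free_of_rank_def)

sublocale L: comm_group L by (rule comm_group_lattice)
sublocale R: comm_group "real_tensor L" by (rule comm_group_real_tensor[OF comm_group_lattice])

definition comb :: "(nat \<Rightarrow> int) \<Rightarrow> 'a" where
  "comb c = (\<Otimes>\<^bsub>L\<^esub>i\<in>{..<n}. b i [^]\<^bsub>L\<^esub> c i)"

text \<open>The point of the real tensor product with real coordinates \<open>t\<close>. Only the
  values of \<open>t\<close> below \<open>n\<close> count; with this proviso,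
  \<open>tens_surj\<close> and \<open>tens_inj\<close> make it a coordinate system.\<close>

definition tens :: "(nat \<Rightarrow> real) \<Rightarrow> (real \<times> 'a \<Rightarrow>\<^sub>0 int) set" where
  "tens t = (\<Otimes>\<^bsub>real_tensor L\<^esub>i\<in>{..<n}. pure_tensor L (t i) (b i))"

definition bil :: "(nat \<Rightarrow> real) \<Rightarrow> (nat \<Rightarrow> real) \<Rightarrow> real" where
  "bil t s = (\<Sum>i<n. \<Sum>j<n. t i * s j * form L (b i) (b j))"

lemma b_closed: "i < n \<Longrightarrow> b i \<in> carrier L"
  using basis by (auto simp: int_basis_def)

lemma comb_closed: "comb c \<in> carrier L"
  unfolding comb_def by (rule L.finprod_closed) (auto simp: b_closed)

lemma comb_add: "comb (\<lambda>i. c i + d i) = comb c \<otimes>\<^bsub>L\<^esub> comb d"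
  unfolding comb_def
  by (rule trans[OF L.finprod_cong' L.finprod_multf]) (auto simp: b_closed L.int_pow_mult)

lemma comb_cong: "(\<And>i. i < n \<Longrightarrow> c i = d i) \<Longrightarrow> comb c = comb d"
  unfolding comb_def by (rule L.finprod_cong') (auto simp: b_closed)

lemma comb_surj: "x \<in> carrier L \<Longrightarrow> \<exists>c. x = comb c"
  using basis unfolding int_basis_def comb_def by blast

text \<open>Uniqueness in \<open>int_basis\<close> holds among functions extensional on the index
  set, so both coefficient functions are first restricted, which leaves the combinations
  unchanged.\<close>

lemma comb_inj:
  assumes "comb c = comb d" "i < n"
  shows "c i = d i"
proof -
  have "\<exists>!c. c \<in> {..<n} \<rightarrow>\<^sub>E UNIV \<and> comb d = comb c"
    using basis comb_closed[of d] unfolding int_basis_def comb_def by blast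
  moreover have "comb (restrict c {..<n}) = comb c" "comb (restrict d {..<n}) = comb d"
    by (rule comb_cong, simp)+
  ultimately have "restrict c {..<n} = restrict d {..<n}"
    using assms(1) by (metis restrict_PiE_iff UNIV_I)
  then show ?thesis using assms(2) by (metis lessThan_iff restrict_apply')
qed

lemma tens_closed: "tens t \<in> carrier (real_tensor L)"
  unfolding tens_def by (rule R.finprod_closed) (auto simp: b_closed pure_tensor_closed)

lemma tens_add: "tens (\<lambda>i. t i + s i) = tens t \<otimes>\<^bsub>real_tensor L\<^esub> tens s"
  unfolding tens_def
  by (rule trans[OF R.finprod_cong' R.finprod_multf])
    (auto simp: b_closed pure_tensor_closed pure_tensor_add_left[OF comm_group_lattice])

lemma tens_cong: "(\<And>i. i < n \<Longrightarrow> t i = s i) \<Longrightarrow> tens t = tens s"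
  unfolding tens_def by (rule R.finprod_cong') (auto simp: b_closed pure_tensor_closed)

lemma tens_zero: "tens (\<lambda>i. 0) = \<one>\<^bsub>real_tensor L\<^esub>"
  unfolding tens_def
  by (rule R.finprod_one_eqI) (simp add: b_closed pure_tensor_zero[OF comm_group_lattice])

lemma pure_tensor_comb: "pure_tensor L r (comb c) = tens (\<lambda>i. of_int (c i) * r)"
  unfolding comb_def tens_def
  by (rule trans[OF hom_finprod[OF comm_group_lattice R.comm_group_axioms
        pure_tensor_hom[OF comm_group_lattice]] R.finprod_cong'])
    (auto simp: b_closed pure_tensor_int_pow[OF comm_group_lattice] pure_tensor_closed)

text \<open>The points \<open>tens t\<close> include the unit and all pure tensors and are closed
  under differences, so induction over the free abelian group reaches every coset.\<close>

lemma tens_surj: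
  assumes "u \<in> carrier (real_tensor L)"
  shows "\<exists>t. u = tens t"
proof -
  let ?F = "free_Abelian_group (UNIV \<times> carrier L) :: (real \<times> 'a \<Rightarrow>\<^sub>0 int) monoid"
  obtain p where p: "Poly_Mapping.keys p \<subseteq> UNIV \<times> carrier L" and u: "u = tensor_kernel L #>\<^bsub>?F\<^esub> p"
    using assms unfolding carrier_real_tensor by auto
  \<comment> \<open>The support condition is part of the induction claim because the difference case
    starts from the induction hypotheses alone.\<close>
  have "Poly_Mapping.keys p \<subseteq> UNIV \<times> carrier L \<and> (\<exists>t. tensor_kernel L #>\<^bsub>?F\<^esub> p = tens t)"
    using p
  proof (induction p rule: frag_induction)
    case zero
    have "tensor_kernel L #>\<^bsub>?F\<^esub> 0 = \<one>\<^bsub>real_tensor L\<^esub>"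
      using subgroup.subset[OF subgroup_tensor_kernel[OF comm_group_lattice]]
        group.coset_mult_one[OF group_free_Abelian_group, of "tensor_kernel L" "UNIV \<times> carrier L"]
      by (simp add: real_tensor_def)
    then show ?case using tens_zero[symmetric] by auto
  next
    case (one y)
    then obtain r x where y: "y = (r, x)" "x \<in> carrier L" by auto
    obtain c where "x = comb c" using comb_surj y(2) by blast
    with y pure_tensor_comb[of r c] show ?case by (auto simp: pure_tensor_def)
  next
    case (diff p q)
    then obtain t s where ts: "tensor_kernel L #>\<^bsub>?F\<^esub> p = tens t" "tensor_kernel L #>\<^bsub>?F\<^esub> q = tens s"
      by blast
    have k: "Poly_Mapping.keys (p - q) \<subseteq> UNIV \<times> carrier L"
      using diff keys_diff[of p q] by blast
    then have c: "tensor_kernel L #>\<^bsub>?F\<^esub> (p - q) \<in> carrier (real_tensor L)"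
      unfolding carrier_real_tensor by auto
    have "(tensor_kernel L #>\<^bsub>?F\<^esub> (p - q)) \<otimes>\<^bsub>real_tensor L\<^esub> tens s = tens t"
      using mult_real_tensor_coset[OF comm_group_lattice k, of q] diff ts by simp
    also have "\<dots> = tens (\<lambda>i. t i - s i) \<otimes>\<^bsub>real_tensor L\<^esub> tens s"
      unfolding tens_add[symmetric] by simp
    finally have "tensor_kernel L #>\<^bsub>?F\<^esub> (p - q) = tens (\<lambda>i. t i - s i)"
      using c tens_closed by (simp add: R.right_cancel)
    with k show ?case by blast
  qed
  with u show ?thesis by blast
qed

lemma real_form_tens: "real_form L (tens t) (tens s) = bil t s"
proof -
  have "real_form L (tens t) (tens s) = (\<Sum>i<n. real_form L (pure_tensor L (t i) (b i)) (tens s))"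
    unfolding tens_def[of t]
    by (rule additive_finprod[OF R.comm_group_axioms])
      (auto simp: real_form_mult[OF lattice] tens_closed b_closed pure_tensor_closed)
  also have "\<dots> = (\<Sum>i<n. \<Sum>j<n. real_form L (pure_tensor L (t i) (b i)) (pure_tensor L (s j) (b j)))"
    unfolding tens_def[of s]
    by (intro sum.cong refl additive_finprod[OF R.comm_group_axioms])
      (auto simp: real_form_mult[OF lattice] b_closed pure_tensor_closed)
  also have "\<dots> = bil t s"
    unfolding bil_def by (simp add: real_form_pure_tensor[OF lattice] b_closed)
  finally show ?thesis .
qed

text \<open>Linear independence over \<open>\<real>\<close> is read off the auxiliary lattice in which \<open>b\<close> is orthonormal:
  it has the same extension of scalars, and its form returns the coordinates.\<close>

lemma tens_inj:
  assumes "tens t = tens s" "k < n"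
  shows "t k = s k"
proof -
  \<comment> \<open>The choice fixes coefficients only below \<open>n\<close>, so the facts about
    \<open>coord\<close> carry a bound on the index.\<close>
  define coord where "coord x = (SOME c. x = comb c)" for x
  have coord: "x = comb (coord x)" if "x \<in> carrier L" for x
    unfolding coord_def by (rule someI_ex[OF comb_surj[OF that]])
  have coord_comb: "coord (comb c) i = c i" if "i < n" for c i
    by (rule comb_inj[OF _ that]) (simp add: coord[OF comb_closed, symmetric])
  have coord_mult: "coord (x \<otimes>\<^bsub>L\<^esub> y) i = coord x i + coord y i"
    if "x \<in> carrier L" "y \<in> carrier L" "i < n" for x y i
    using coord_comb[of i "\<lambda>i. coord x i + coord y i"] that
    unfolding comb_add coord[OF that(1), symmetric] coord[OF that(2), symmetric] by simp
  have coord_b: "coord (b j) i = (if i = j then 1 else 0)" if "i < n" "j < n" for i j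
  proof -
    have "comb (\<lambda>i. if i = j then 1 else 0) = (\<Otimes>\<^bsub>L\<^esub>i\<in>{..<n}. if j = i then b i else \<one>\<^bsub>L\<^esub>)"
      unfolding comb_def by (rule L.finprod_cong') (auto simp: b_closed)
    also have "\<dots> = b j"
      using that(2) by (subst L.finprod_singleton) (auto simp: b_closed)
    finally show ?thesis using coord_comb[OF that(1), of "\<lambda>i. if i = j then 1 else 0"] by simp
  qed
  define E where "E = L\<lparr>form := \<lambda>x y. \<Sum>i<n. of_int (coord x i) * of_int (coord y i)\<rparr>"
  have [simp]: "carrier E = carrier L" "monoid.mult E = monoid.mult L" "one E = one L"
    "form E = (\<lambda>x y. \<Sum>i<n. of_int (coord x i) * of_int (coord y i))"
    by (simp_all add: E_def)
  have pow: "x [^]\<^bsub>E\<^esub> (k::int) = x [^]\<^bsub>L\<^esub> k" for x k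
    by (simp add: int_pow_def nat_pow_def m_inv_def Let_def)
  have prod: "finprod E f I = finprod L f I" for f and I :: "nat set"
    by (simp add: finprod_def)
  have "comm_group E"
    by (rule comm_groupI) (auto simp: L.m_assoc intro: L.m_comm L.l_inv_ex)
  moreover have ib: "int_basis E n b"
    using basis by (simp add: int_basis_def pow prod)
  ultimately have "is_lattice E"
    unfolding is_lattice_def free_of_rank_def
    by (auto simp: coord_mult distrib_left distrib_right sum.distrib mult.commute)
  then interpret E: based_lattice E n b using ib by unfold_locales
  have "tensor_kernel E = tensor_kernel L"
    by (simp add: tensor_kernel_def tensor_relations_def)
  then have RT: "real_tensor E = real_tensor L" "pure_tensor E = pure_tensor L"
    by (simp_all add: real_tensor_def pure_tensor_def fun_eq_iff)
  have tens: "E.tens u = tens u" for u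
    unfolding E.tens_def tens_def RT ..
  have ortho: "form E (b i) (b j) = (if j = i then 1 else 0)" if "i < n" "j < n" for i j
  proof -
    have "form E (b i) (b j) = (\<Sum>m<n. of_int (coord (b i) m) * of_int (coord (b j) m))" by simp
    also have "\<dots> = (\<Sum>m<n. if m = i then (if j = i then 1 else 0) else 0)"
      by (rule sum.cong) (use that in \<open>auto simp: coord_b\<close>)
    finally show ?thesis using that by simp
  qed
  have bil: "E.bil u (\<lambda>i. if i = k then 1 else 0) = u k" for u
  proof -
    have "E.bil u (\<lambda>i. if i = k then 1 else 0) =
        (\<Sum>i<n. \<Sum>j<n. if k = j then (if k = i then u i else 0) else 0)"
      unfolding E.bil_def
      by (intro sum.cong refl) (auto simp: ortho simp del: \<open>form E = _\<close>)
    then show ?thesis using assms(2) by simp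
  qed
  show ?thesis
    using E.real_form_tens[of t "\<lambda>i. if i = k then 1 else 0"]
      E.real_form_tens[of s "\<lambda>i. if i = k then 1 else 0"]
    unfolding bil tens assms(1) by simp
qed

end

section \<open>The discriminant module in coordinates\<close>

definition (in based_lattice) integral :: "(nat \<Rightarrow> real) \<Rightarrow> bool" where
  "integral t \<longleftrightarrow> (\<forall>i<n. t i \<in> \<int>)"

text \<open>Duality is tested on basis vectors; \<open>dual_iff_bil\<close> extends the test to all
  integral vectors.\<close>

definition (in based_lattice) dual :: "(nat \<Rightarrow> real) \<Rightarrow> bool" where
  "dual t \<longleftrightarrow> (\<forall>j<n. (\<Sum>i<n. t i * form L (b i) (b j)) \<in> \<int>)"

text \<open>The coset of \<open>tens t\<close> modulo the lattice; \<open>r_coset_tens\<close>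
  matches it with the coset of the quotient group.\<close>

definition (in based_lattice) cl :: "(nat \<Rightarrow> real) \<Rightarrow> (real \<times> 'a \<Rightarrow>\<^sub>0 int) set set" where
  "cl t = tens ` {u. integral (\<lambda>i. u i - t i)}"

locale even_based_lattice = based_lattice +
  assumes even: "even_form L"
begin

lemma integral_add: "integral t \<Longrightarrow> integral s \<Longrightarrow> integral (\<lambda>i. t i + s i)"
  by (simp add: integral_def)

lemma integral_diff: "integral t \<Longrightarrow> integral s \<Longrightarrow> integral (\<lambda>i. t i - s i)"
  by (simp add: integral_def)

lemma integral_of_int_mult: "integral t \<Longrightarrow> integral (\<lambda>i. of_int k * t i)"
  by (simp add: integral_def)

lemma dual_of_int_mult: "dual t \<Longrightarrow> dual (\<lambda>i. of_int k * t i)"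
  by (simp add: dual_def mult.assoc sum_distrib_left[symmetric])

lemma form_b_Ints: "i < n \<Longrightarrow> j < n \<Longrightarrow> form L (b i) (b j) \<in> \<int>"
  using even b_closed unfolding even_form_def by blast

lemma form_b_commute: "i < n \<Longrightarrow> j < n \<Longrightarrow> form L (b i) (b j) = form L (b j) (b i)"
  using lattice b_closed unfolding is_lattice_def by blast

lemma integral_obtain_comb:
  assumes "integral t"
  obtains c where "tens t = pure_tensor L 1 (comb c)"
proof -
  have "tens t = tens (\<lambda>i. of_int \<lfloor>t i\<rfloor> * 1)"
    by (rule tens_cong) (use assms in \<open>auto simp: integral_def elim: Ints_cases\<close>)
  then show thesis using that pure_tensor_comb[of 1] by metis
qed

lemma pure_tensor_image: "pure_tensor L 1 ` carrier L = tens ` {t. integral t}"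
proof (intro equalityI subsetI)
  fix u assume "u \<in> pure_tensor L 1 ` carrier L"
  then obtain c where "u = pure_tensor L 1 (comb c)" using comb_surj by blast
  then show "u \<in> tens ` {t. integral t}"
    unfolding pure_tensor_comb by (auto simp: integral_def)
next
  fix u assume "u \<in> tens ` {t. integral t}"
  then show "u \<in> pure_tensor L 1 ` carrier L"
    using comb_closed by (auto elim!: integral_obtain_comb)
qed

lemma bil_commute: "bil t s = bil s t"
  unfolding bil_def
  by (subst sum.swap) (auto intro!: sum.cong simp: form_b_commute)

lemma bil_add_left: "bil (\<lambda>i. t i + u i) s = bil t s + bil u s"
  unfolding bil_def by (simp add: distrib_right sum.distrib)

lemma bil_add_right: "bil s (\<lambda>i. t i + u i) = bil s t + bil s u"
  using bil_add_left bil_commute by metis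

lemma bil_scale: "bil (\<lambda>i. k * t i) (\<lambda>i. k * t i) = k\<^sup>2 * bil t t"
  unfolding bil_def by (simp add: sum_distrib_left power2_eq_square mult_ac)

lemma bil_alt: "bil t s = (\<Sum>j<n. s j * (\<Sum>i<n. t i * form L (b i) (b j)))"
  unfolding bil_def by (subst sum.swap) (simp add: sum_distrib_left mult_ac)

lemma bil_dual_integral: "dual t \<Longrightarrow> integral s \<Longrightarrow> bil t s \<in> \<int>"
  unfolding bil_alt dual_def integral_def by (rule Ints_sum, rule Ints_mult) auto

lemma dual_iff_bil: "dual t \<longleftrightarrow> (\<forall>s. integral s \<longrightarrow> bil t s \<in> \<int>)"
proof
  assume *: "\<forall>s. integral s \<longrightarrow> bil t s \<in> \<int>"
  show "dual t"
    unfolding dual_def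
  proof (intro allI impI)
    fix j assume j: "j < n"
    have "bil t (\<lambda>i. if i = j then 1 else 0) = (\<Sum>i<n. t i * form L (b i) (b j))"
      unfolding bil_alt using j by (simp add: if_distrib[of "\<lambda>x. x * _"] cong: if_cong)
    moreover have "integral (\<lambda>i. if i = j then 1 else 0)" by (simp add: integral_def)
    ultimately show "(\<Sum>i<n. t i * form L (b i) (b j)) \<in> \<int>" using * by metis
  qed
qed (use bil_dual_integral in blast)

text \<open>An integral vector is the image of a lattice element, whose norm is even. This makes
  half the norm well defined on classes.\<close>

lemma bil_integral_even:
  assumes "integral t"
  shows "bil t t / 2 \<in> \<int>"
proof -
  obtain c where c: "tens t = pure_tensor L 1 (comb c)" using integral_obtain_comb[OF assms] .
  have "bil t t = form L (comb c) (comb c)"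
    unfolding real_form_tens[symmetric] c by (simp add: real_form_pure_tensor[OF lattice] comb_closed)
  moreover obtain k :: int where "form L (comb c) (comb c) = 2 * of_int k"
    using even comb_closed[of c] unfolding even_form_def by blast
  ultimately show ?thesis by simp
qed

section \<open>The discriminant group and its quadratic form on classes of coordinate
  vectors\<close>

lemma dual_lattice_eq: "dual_lattice L = tens ` {t. dual t}"
proof -
  have "(\<forall>w\<in>carrier L. real_form L (tens t) (pure_tensor L 1 w) \<in> \<int>) \<longleftrightarrow> dual t" for t
  proof -
    have "(\<forall>w\<in>carrier L. real_form L (tens t) (pure_tensor L 1 w) \<in> \<int>) \<longleftrightarrow>
        (\<forall>v\<in>pure_tensor L 1 ` carrier L. real_form L (tens t) v \<in> \<int>)" by simp
    also have "\<dots> \<longleftrightarrow> dual t"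
      unfolding pure_tensor_image dual_iff_bil by (simp add: real_form_tens)
    finally show ?thesis .
  qed
  then show ?thesis
    unfolding dual_lattice_def using tens_surj tens_closed by blast
qed

lemma r_coset_tens:
  "(pure_tensor L 1 ` carrier L) #>\<^bsub>real_tensor L\<^esub> tens t = cl t"
proof -
  have "(pure_tensor L 1 ` carrier L) #>\<^bsub>real_tensor L\<^esub> tens t =
      (\<lambda>s. tens (\<lambda>i. s i + t i)) ` {s. integral s}"
    unfolding r_coset_def pure_tensor_image by (auto simp: tens_add)
  also have "\<dots> = cl t"
    unfolding cl_def
  proof (intro equalityI subsetI)
    fix x assume "x \<in> tens ` {u. integral (\<lambda>i. u i - t i)}"
    then obtain u where u: "x = tens u" "integral (\<lambda>i. u i - t i)" by blast
    then have "x = tens (\<lambda>i. (u i - t i) + t i)" by simp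
    with u(2) show "x \<in> (\<lambda>s. tens (\<lambda>i. s i + t i)) ` {s. integral s}"
      by (intro image_eqI[where x = "\<lambda>i. u i - t i"]) auto
  next
    fix x assume "x \<in> (\<lambda>s. tens (\<lambda>i. s i + t i)) ` {s. integral s}"
    then obtain s where s: "x = tens (\<lambda>i. s i + t i)" "integral s" by blast
    then show "x \<in> tens ` {u. integral (\<lambda>i. u i - t i)}"
      by (intro image_eqI[where x = "\<lambda>i. s i + t i"]) auto
  qed
  finally show ?thesis .
qed

lemma carrier_discriminant: "carrier (discriminant_module L) = cl ` {t. dual t}"
  by (simp add: discriminant_module_def discriminant_group_def carrier_FactGroup dual_lattice_eq
      image_image r_coset_tens)

text \<open>A class contains its own representative, and \<open>tens_inj\<close> turns equality of
  points into equality of coordinates.\<close>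

lemma cl_eq_iff: "cl t = cl s \<longleftrightarrow> integral (\<lambda>i. t i - s i)"
proof
  assume "cl t = cl s"
  moreover have "tens t \<in> cl t" by (auto simp: cl_def integral_def)
  ultimately obtain u where "tens t = tens u" "integral (\<lambda>i. u i - s i)" by (auto simp: cl_def)
  then show "integral (\<lambda>i. t i - s i)" unfolding integral_def by (metis tens_inj)
next
  assume *: "integral (\<lambda>i. t i - s i)"
  have "integral (\<lambda>i. u i - t i) \<longleftrightarrow> integral (\<lambda>i. u i - s i)" for u
    using integral_add[OF _ *, of "\<lambda>i. u i - t i"] integral_diff[OF _ *, of "\<lambda>i. u i - s i"] by auto
  then show "cl t = cl s" by (simp add: cl_def)
qed

lemma mult_discriminant: "cl t \<otimes>\<^bsub>discriminant_module L\<^esub> cl s = cl (\<lambda>i. t i + s i)"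
proof -
  have "cl t \<otimes>\<^bsub>discriminant_module L\<^esub> cl s =
      {tens (\<lambda>i. u i + v i) | u v. integral (\<lambda>i. u i - t i) \<and> integral (\<lambda>i. v i - s i)}"
    unfolding discriminant_module_def discriminant_group_def cl_def
    by (auto simp: set_mult_def tens_add)
  also have "\<dots> = cl (\<lambda>i. t i + s i)"
  proof (intro equalityI subsetI)
    fix x assume "x \<in> cl (\<lambda>i. t i + s i)"
    then obtain u where u: "x = tens u" "integral (\<lambda>i. u i - (t i + s i))" by (auto simp: cl_def)
    have "x = tens (\<lambda>i. (u i - s i) + s i)" using u by simp
    moreover have "integral (\<lambda>i. (u i - s i) - t i)" "integral (\<lambda>i. s i - s i)"
      using u(2) by (simp_all add: integral_def algebra_simps)
    ultimately show "x \<in> {tens (\<lambda>i. u i + v i) | u v. integral (\<lambda>i. u i - t i) \<and> integral (\<lambda>i. v i - s i)}"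
      by (intro CollectI exI[of _ "\<lambda>i. u i - s i"] exI[of _ s]) blast
  next
    fix x assume "x \<in> {tens (\<lambda>i. u i + v i) | u v. integral (\<lambda>i. u i - t i) \<and> integral (\<lambda>i. v i - s i)}"
    then obtain u v where x: "x = tens (\<lambda>i. u i + v i)"
      and uv: "integral (\<lambda>i. u i - t i)" "integral (\<lambda>i. v i - s i)" by blast
    from integral_add[OF uv] have "integral (\<lambda>i. (u i + v i) - (t i + s i))"
      by (simp add: algebra_simps)
    then show "x \<in> cl (\<lambda>i. t i + s i)" unfolding cl_def x by blast
  qed
  finally show ?thesis .
qed

text \<open>Replacing \<open>t\<close> by \<open>t + d\<close> with \<open>d\<close> integral
  changes half the norm by \<open>bil t d + bil d d / 2\<close>. The first term is an integer by
  duality, the second by evenness, so \<open>the_elem\<close> is applied to a singleton.\<close>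

lemma quad_discriminant:
  assumes "dual t"
  shows "quad (discriminant_module L) (cl t) = mod_int (bil t t / 2)"
proof -
  have *: "mod_int (bil u u / 2) = mod_int (bil t t / 2)" if "integral (\<lambda>i. u i - t i)" for u
  proof -
    define d where "d = (\<lambda>i. u i - t i)"
    have u: "u = (\<lambda>i. t i + d i)" by (simp add: d_def)
    have "bil u u / 2 - bil t t / 2 = bil t d + bil d d / 2"
      unfolding u bil_add_left bil_add_right using bil_commute[of d t] by (simp add: field_simps)
    also have "\<dots> \<in> \<int>"
      using bil_dual_integral[OF assms] bil_integral_even that by (simp add: d_def)
    finally show ?thesis by (simp add: mod_int_eq_iff)
  qed
  have "(\<lambda>v. mod_int (real_form L v v / 2)) ` cl t = {mod_int (bil t t / 2)}"
  proof (intro equalityI subsetI)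
    fix x assume "x \<in> (\<lambda>v. mod_int (real_form L v v / 2)) ` cl t"
    then show "x \<in> {mod_int (bil t t / 2)}" using * by (auto simp: cl_def real_form_tens)
  next
    fix x assume "x \<in> {mod_int (bil t t / 2)}"
    then show "x \<in> (\<lambda>v. mod_int (real_form L v v / 2)) ` cl t"
      by (intro image_eqI[where x = "tens t"]) (auto simp: cl_def real_form_tens integral_def)
  qed
  then show ?thesis by (simp add: discriminant_module_def)
qed

text \<open>\<open>w\<close> represents the class sent to 1. Additivity forces the class of
  \<open>k\<close> times \<open>w\<close> to go to \<open>k mod 2 ^ r\<close>, and injectivity turns
  this into the order of \<open>w\<close> and the fact that it generates.\<close>

lemma isometric_A_moduleD:
  assumes "r \<ge> 1" "isometrically_isomorphic (discriminant_module L) (A_module r a)"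
  shows "\<exists>w. dual w \<and> (\<forall>k::int. integral (\<lambda>i. of_int k * w i) \<longleftrightarrow> 2 ^ r dvd k) \<and>
      (\<forall>t. dual t \<longrightarrow> (\<exists>k::int. integral (\<lambda>i. t i - of_int k * w i))) \<and>
      bil w w / 2 - of_int a / 2 ^ (r + 1) \<in> \<int>"
proof -
  obtain f where f: "f \<in> iso (discriminant_module L) (A_module r a)"
    and q: "\<And>x. x \<in> carrier (discriminant_module L) \<Longrightarrow> quad (A_module r a) (f x) = quad (discriminant_module L) x"
    using assms(2) unfolding isometrically_isomorphic_def by blast
  have bij: "bij_betw f (cl ` {t. dual t}) {0..<2 ^ r}"
    using f by (simp add: iso_def carrier_discriminant)
  define F where "F t = f (cl t)" for t
  have range: "0 \<le> F t" "F t < 2 ^ r" if "dual t" for t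
    using bij that unfolding bij_betw_def F_def by force+
  have inj: "cl t = cl s" if "F t = F s" "dual t" "dual s" for t s
    using bij that unfolding bij_betw_def inj_on_def F_def by blast
  have add: "F (\<lambda>i. t i + s i) = (F t + F s) mod 2 ^ r" if "dual t" "dual s" for t s
    using f that by (simp add: iso_def hom_def carrier_discriminant F_def flip: mult_discriminant)
  have "(1::int) < 2 ^ r" using assms(1) by (simp add: one_less_power)
  then have "1 \<in> f ` cl ` {t. dual t}" using bij by (simp add: bij_betw_def)
  then obtain w where w: "dual w" "F w = 1" by (auto simp: F_def)
  have dual0: "dual (\<lambda>i. 0)" by (simp add: dual_def)
  have zero: "F (\<lambda>i. 0) = 0"
  proof -
    have "F (\<lambda>i. 0) = (F (\<lambda>i. 0) + F (\<lambda>i. 0)) mod 2 ^ r" using add[OF dual0 dual0] by simp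
    \<comment> \<open>The summand 0 brings the equation into the form of a congruence whose two
      sides differ by \<open>F (\<lambda>i. 0)\<close>.\<close>
    then have "(F (\<lambda>i. 0) + 0) mod 2 ^ r = (F (\<lambda>i. 0) + F (\<lambda>i. 0)) mod 2 ^ r"
      using range[OF dual0] by simp
    then have "2 ^ r dvd F (\<lambda>i. 0)" by (simp add: mod_eq_dvd_iff)
    with range[OF dual0] show ?thesis by (metis dvd_imp_mod_0 mod_pos_pos_trivial)
  qed
  note dw = dual_of_int_mult[OF w(1)]
  have step: "F (\<lambda>i. of_int (k + 1) * w i) = (F (\<lambda>i. of_int k * w i) + 1) mod 2 ^ r" for k :: int
    using add[OF dw w(1), of k] w(2) by (simp add: distrib_right)
  have mult: "F (\<lambda>i. of_int k * w i) = k mod 2 ^ r" for k :: int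
  proof (induction k rule: int_induct[where k = 0])
    case base
    then show ?case by (simp add: zero)
  next
    case (step1 k)
    then show ?case using step[of k] by (simp add: mod_add_left_eq)
  next
    case (step2 k)
    have "(F (\<lambda>i. of_int (k - 1) * w i) + 1) mod 2 ^ r = ((k - 1) + 1) mod 2 ^ r"
      using step[of "k - 1"] step2 by simp
    \<comment> \<open>Cancelling 1 is possible only as a congruence; the range of \<open>F\<close>
      turns it back into an equality.\<close>
    then have "F (\<lambda>i. of_int (k - 1) * w i) mod 2 ^ r = (k - 1) mod 2 ^ r"
      by (simp only: mod_eq_dvd_iff add_diff_cancel_right)
    then show ?case using range[OF dw[of "k - 1"]] by simp
  qed
  have order: "integral (\<lambda>i. of_int k * w i) \<longleftrightarrow> 2 ^ r dvd k" for k :: int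
  proof -
    have "integral (\<lambda>i. of_int k * w i) \<longleftrightarrow> cl (\<lambda>i. of_int k * w i) = cl (\<lambda>i. 0)"
      by (simp add: cl_eq_iff)
    also have "\<dots> \<longleftrightarrow> F (\<lambda>i. of_int k * w i) = F (\<lambda>i. 0)"
      using inj[OF _ dw dual0] by (auto simp: F_def)
    also have "\<dots> \<longleftrightarrow> 2 ^ r dvd k" by (simp add: mult zero dvd_eq_mod_eq_0)
    finally show ?thesis .
  qed
  \<comment> \<open>The coefficient of \<open>t\<close> along \<open>w\<close> is \<open>F t\<close>
    itself, since \<open>F\<close> then takes the same value on both vectors.\<close>
  have gen: "integral (\<lambda>i. t i - of_int (F t) * w i)" if "dual t" for t
    unfolding cl_eq_iff[symmetric] by (rule inj) (use that range[OF that] in \<open>simp_all add: mult dw\<close>)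
  have "mod_int (bil w w / 2) = mod_int (of_int a / 2 ^ (r + 1))"
    using q[of "cl w"] w by (simp add: carrier_discriminant quad_discriminant flip: F_def)
  with w(1) order gen show ?thesis by (auto simp: mod_int_eq_iff)
qed

text \<open>The map from \<open>k\<close> to the class of \<open>k\<close> times \<open>w\<close> is
  well defined and injective by the order of \<open>w\<close>, and onto because \<open>w\<close>
  generates. Multiplying the congruence \<open>quad\<close> by \<open>k\<^sup>2\<close> shows that
  it preserves the quadratic form; its inverse is the isometry sought.\<close>

lemma isometric_A_moduleI:
  assumes "r \<ge> 1" "odd a" "dual w" and order: "\<And>k::int. integral (\<lambda>i. of_int k * w i) \<longleftrightarrow> 2 ^ r dvd k"
    and gen: "\<And>t. dual t \<Longrightarrow> \<exists>k::int. integral (\<lambda>i. t i - of_int k * w i)"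
    and quad: "bil w w / 2 - of_int a / 2 ^ (r + 1) \<in> \<int>"
  shows "isometrically_isomorphic (discriminant_module L) (A_module r a)"
proof -
  define g where "g k = cl (\<lambda>i. of_int k * w i)" for k :: int
  have g_eq: "g k = g m \<longleftrightarrow> 2 ^ r dvd k - m" for k m
    unfolding g_def cl_eq_iff order[symmetric] by (simp add: left_diff_distrib)
  then have g_mod: "g (k mod 2 ^ r) = g k" for k
    by (metis mod_eq_dvd_iff mod_mod_trivial)
  have g_add: "g (k + m) = g k \<otimes>\<^bsub>discriminant_module L\<^esub> g m" for k m
    unfolding g_def mult_discriminant by (simp add: distrib_right)
  note dw = dual_of_int_mult[OF assms(3)]
  have "g k \<in> carrier (discriminant_module L)" for k
    by (simp add: g_def carrier_discriminant dw)
  then have "g \<in> hom (A_module r a) (discriminant_module L)"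
    by (intro homI) (simp_all add: g_mod g_add)
  moreover have "bij_betw g {0..<2 ^ r} (cl ` {t. dual t})"
    unfolding bij_betw_def
  proof (intro conjI inj_onI equalityI subsetI)
    fix x y assume "x \<in> {0..<2 ^ r}" "y \<in> {0..<2 ^ r}" "g x = g y"
    then show "x = y" unfolding g_eq mod_eq_dvd_iff[symmetric] by simp
  next
    fix X assume "X \<in> cl ` {t. dual t}"
    then obtain t where t: "X = cl t" "dual t" by blast
    obtain k where "X = g k" using gen[OF t(2)] t(1) by (auto simp: g_def cl_eq_iff)
    then have "X = g (k mod 2 ^ r)" by (simp add: g_mod)
    then show "X \<in> g ` {0..<2 ^ r}" by (rule image_eqI) simp
  qed (auto simp: g_def dw)
  ultimately have g: "g \<in> iso (A_module r a) (discriminant_module L)"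
    by (simp add: iso_def carrier_discriminant)
  have qg: "quad (discriminant_module L) (g k) = quad (A_module r a) k" for k
  proof -
    have "of_int (k\<^sup>2) * (bil w w / 2 - of_int a / 2 ^ (r + 1)) \<in> \<int>"
      by (rule Ints_mult[OF Ints_of_int quad])
    then have "(of_int k)\<^sup>2 * bil w w / 2 - of_int a / 2 ^ (r + 1) * (of_int k)\<^sup>2 \<in> \<int>"
      by (simp add: algebra_simps)
    then show ?thesis
      unfolding g_def quad_discriminant[OF dw] bil_scale A_module_simps mod_int_eq_iff .
  qed
  interpret A: comm_group "A_module r a"
    using finite_quadratic_module_A_module[OF assms(1,2)] by (simp add: finite_quadratic_module_def)
  let ?f = "inv_into (carrier (A_module r a)) g"
  have "?f \<in> iso (discriminant_module L) (A_module r a)"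
    by (rule A.iso_set_sym[OF g])
  moreover have "quad (A_module r a) (?f x) = quad (discriminant_module L) x"
    if "x \<in> carrier (discriminant_module L)" for x
  proof -
    have "x \<in> g ` carrier (A_module r a)"
      using g that by (simp add: iso_def bij_betw_def)
    then have "g (?f x) = x" by (rule f_inv_into_f)
    then show ?thesis using qg[of "?f x"] by simp
  qed
  ultimately show ?thesis unfolding isometrically_isomorphic_def by blast
qed

end

section \<open>Lattices given by a Gram matrix\<close>

text \<open>The new row and the new column contribute equally, so each induction step adds twice an
  integer and an even diagonal entry.\<close>

lemma even_symmetric_double_sum:
  fixes h :: "nat \<Rightarrow> nat \<Rightarrow> int"
  assumes "\<And>i j. i < n \<Longrightarrow> j < n \<Longrightarrow> h i j = h j i" "\<And>i. i < n \<Longrightarrow> even (h i i)"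
  shows "even (\<Sum>i<n. \<Sum>j<n. h i j)"
  using assms
proof (induction n)
  case (Suc n)
  have "(\<Sum>j<n. h n j) = (\<Sum>i<n. h i n)" using Suc.prems(1) by (intro sum.cong) auto
  then have "(\<Sum>i<Suc n. \<Sum>j<Suc n. h i j) = (\<Sum>i<n. \<Sum>j<n. h i j) + 2 * (\<Sum>i<n. h i n) + h n n"
    by (simp add: sum.distrib)
  with Suc show ?case by simp
qed simp

text \<open>The entries are integers, so that parity can be expressed; they become real only inside
  \<open>gram_lattice\<close>.\<close>

locale even_gram =
  fixes n :: nat and g :: "nat \<Rightarrow> nat \<Rightarrow> int" and L
  assumes sym: "\<And>i j. i < n \<Longrightarrow> j < n \<Longrightarrow> g i j = g j i"
    and even_diag: "\<And>i. i < n \<Longrightarrow> even (g i i)"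
  defines "L \<equiv> gram_lattice (mat n n (\<lambda>(i, j). of_int (g i j)))"
begin

lemma L_simps [simp]: "carrier L = carrier_vec n" "monoid.mult L = (+)" "one L = 0\<^sub>v n"
  by (simp_all add: L_def gram_lattice_def)

lemma form_L:
  assumes "x \<in> carrier_vec n" "y \<in> carrier_vec n"
  shows "form L x y = of_int (\<Sum>i<n. \<Sum>j<n. x $ i * g i j * y $ j)"
proof -
  have "form L x y = (\<Sum>i<n. of_int (x $ i) * (\<Sum>j<n. of_int (g i j) * of_int (y $ j)))"
    using assms by (simp add: L_def gram_lattice_def scalar_prod_def mult_mat_vec_def lessThan_atLeast0)
  then show ?thesis by (simp add: sum_distrib_left mult_ac)
qed

lemma comm_group_L: "comm_group L"
proof (rule comm_groupI)
  fix x assume "x \<in> carrier L"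
  then show "\<exists>y\<in>carrier L. y \<otimes>\<^bsub>L\<^esub> x = \<one>\<^bsub>L\<^esub>"
    by (intro bexI[of _ "- x"]) auto
qed (auto simp: comm_add_vec)

sublocale L: comm_group L by (rule comm_group_L)

lemma int_pow_L:
  assumes "x \<in> carrier_vec n"
  shows "x [^]\<^bsub>L\<^esub> (k::int) = k \<cdot>\<^sub>v x"
proof -
  have nat: "x [^]\<^bsub>L\<^esub> m = int m \<cdot>\<^sub>v x" for m :: nat
  proof (induction m)
    case 0
    then show ?case using assms by (auto intro!: eq_vecI)
  next
    case (Suc m)
    then show ?case using assms by (auto intro!: eq_vecI simp: distrib_right)
  qed
  have inv: "inv\<^bsub>L\<^esub> y = - y" if "y \<in> carrier_vec n" for y
    using that by (intro L.inv_equality) auto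
  show ?thesis
  proof (cases k)
    case (nonneg m)
    then show ?thesis by (simp add: int_pow_int nat)
  next
    case (neg m)
    have "x [^]\<^bsub>L\<^esub> k = inv\<^bsub>L\<^esub> (x [^]\<^bsub>L\<^esub> Suc m)"
      unfolding neg using assms by (simp only: L.int_pow_neg L_simps int_pow_int)
    also have "\<dots> = k \<cdot>\<^sub>v x"
      unfolding nat neg using assms by (subst inv) (auto intro!: eq_vecI simp: algebra_simps)
    finally show ?thesis .
  qed
qed

lemma finprod_unit_vec: "(\<Otimes>\<^bsub>L\<^esub>i\<in>{..<n}. unit_vec n i [^]\<^bsub>L\<^esub> c i) = vec n c"
proof (rule eq_vecI)
  have closed: "(\<lambda>i. unit_vec n i [^]\<^bsub>L\<^esub> c i) \<in> {..<n} \<rightarrow> carrier L"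
    by (auto simp: int_pow_L)
  show "dim_vec (\<Otimes>\<^bsub>L\<^esub>i\<in>{..<n}. unit_vec n i [^]\<^bsub>L\<^esub> c i) = dim_vec (vec n c)"
    using L.finprod_closed[OF closed] by auto
  fix k assume "k < dim_vec (vec n c)"
  then have k: "k < n" by simp
  \<comment> \<open>Taking the \<open>k\<close>-th coordinate is additive on the group, so it passes
    through the product.\<close>
  have "(\<Otimes>\<^bsub>L\<^esub>i\<in>{..<n}. unit_vec n i [^]\<^bsub>L\<^esub> c i) $ k =
      (\<Sum>i<n. (unit_vec n i [^]\<^bsub>L\<^esub> c i) $ k)"
    by (rule additive_finprod[OF comm_group_L _ _ closed]) (use k in auto)
  also have "\<dots> = (\<Sum>i<n. if k = i then c i else 0)"
    by (rule sum.cong) (use k in \<open>auto simp: int_pow_L\<close>)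
  finally show "(\<Otimes>\<^bsub>L\<^esub>i\<in>{..<n}. unit_vec n i [^]\<^bsub>L\<^esub> c i) $ k = vec n c $ k"
    using k by simp
qed

lemma int_basis_L: "int_basis L n (unit_vec n)"
  unfolding int_basis_def finprod_unit_vec
proof (intro conjI ballI)
  fix x assume "x \<in> carrier L"
  then have x: "dim_vec x = n" by simp
  show "\<exists>!c. c \<in> {..<n} \<rightarrow>\<^sub>E UNIV \<and> x = vec n c"
  proof (rule ex1I)
    show "(\<lambda>i\<in>{..<n}. x $ i) \<in> {..<n} \<rightarrow>\<^sub>E UNIV \<and> x = vec n (\<lambda>i\<in>{..<n}. x $ i)"
      using x by (auto intro!: eq_vecI)
  next
    fix c assume "c \<in> {..<n} \<rightarrow>\<^sub>E UNIV \<and> x = vec n c"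
    then show "c = (\<lambda>i\<in>{..<n}. x $ i)" by (auto simp: PiE_def extensional_def restrict_def)
  qed
qed auto

lemma form_unit_vec:
  assumes "i < n" "j < n"
  shows "form L (unit_vec n i) (unit_vec n j) = of_int (g i j)"
proof -
  have "form L (unit_vec n i) (unit_vec n j) =
      of_int (\<Sum>k<n. \<Sum>l<n. if l = j then if k = i then g k l else 0 else 0)"
    unfolding form_L[OF unit_vec_carrier unit_vec_carrier]
    by (intro arg_cong[of _ _ of_int] sum.cong refl) (auto simp: assms)
  then show ?thesis using assms by simp
qed

sublocale even_based_lattice L n "unit_vec n"
proof
  show "int_basis L n (unit_vec n)" by (rule int_basis_L)
  have "form L x y = form L y x" if "x \<in> carrier_vec n" "y \<in> carrier_vec n" for x y
    unfolding form_L[OF that] form_L[OF that(2,1)]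
    by (subst sum.swap) (auto intro!: sum.cong simp: sym)
  moreover have "form L (x + y) z = form L x z + form L y z"
    if "x \<in> carrier_vec n" "y \<in> carrier_vec n" "z \<in> carrier_vec n" for x y z
    using that by (simp add: form_L distrib_right sum.distrib)
  moreover have "form L z (x + y) = form L z x + form L z y"
    if "x \<in> carrier_vec n" "y \<in> carrier_vec n" "z \<in> carrier_vec n" for x y z
    using that by (simp add: form_L distrib_left sum.distrib)
  ultimately show "is_lattice L"
    unfolding is_lattice_def free_of_rank_def using comm_group_L int_basis_L by auto
  have even_sum: "even (\<Sum>i<n. \<Sum>j<n. x $ i * g i j * x $ j)" for x
    by (rule even_symmetric_double_sum) (auto simp: sym even_diag)
  have "\<exists>k::int. form L x x = 2 * of_int k" if "x \<in> carrier_vec n" for x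
  proof -
    obtain k where "(\<Sum>i<n. \<Sum>j<n. x $ i * g i j * x $ j) = 2 * k"
      using even_sum[of x] by (elim evenE)
    then have "form L x x = 2 * of_int k" unfolding form_L[OF that that] by simp
    then show ?thesis ..
  qed
  moreover have "form L x y \<in> \<int>" if "x \<in> carrier_vec n" "y \<in> carrier_vec n" for x y
    unfolding form_L[OF that] by (rule Ints_of_int)
  ultimately show "even_form L" unfolding even_form_def by simp
qed

text \<open>A vanishing determinant would give a nonzero kernel vector. By symmetry of
  \<open>g\<close> it solves the homogeneous system of the hypothesis, which is the form in which
  the dual lattice is computed.\<close>

lemma even_nondegenerate_L:
  assumes "\<And>t::nat \<Rightarrow> real. \<forall>j<n. (\<Sum>i<n. t i * of_int (g i j)) = 0 \<Longrightarrow> \<forall>i<n. t i = 0"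
  shows "even_nondegenerate_lattice L"
proof -
  let ?G = "mat n n (\<lambda>(i, j). of_int (g i j)) :: real mat"
  have "gram_matrix L n (unit_vec n) = ?G"
    by (rule eq_matI) (auto simp: gram_matrix_def form_unit_vec)
  moreover have "det ?G \<noteq> 0"
  proof
    assume "det ?G = 0"
    then obtain v where v: "v \<in> carrier_vec n" "v \<noteq> 0\<^sub>v n" "?G *\<^sub>v v = 0\<^sub>v n"
      using det_0_iff_vec_prod_zero[of ?G n] by auto
    have "(\<Sum>i<n. v $ i * of_int (g i j)) = 0" if j: "j < n" for j
    proof -
      have "(\<Sum>i<n. v $ i * of_int (g i j)) = (?G *\<^sub>v v) $ j"
        using j v(1) by (simp add: scalar_prod_def lessThan_atLeast0) (auto intro!: sum.cong simp: sym)
      then show ?thesis using v(3) j by simp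
    qed
    then have "\<forall>i<n. v $ i = 0" using assms[of "($) v"] by blast
    then have "v = 0\<^sub>v n" using v(1) by (intro eq_vecI) auto
    with v(2) show False ..
  qed
  ultimately show ?thesis
    unfolding even_nondegenerate_lattice_def nondegenerate_def
    using lattice even int_basis_L by metis
qed

end

section \<open>Lattices realising the modules of the theorem\<close>

text \<open>Hensel lifting at 2. If the quotient \<open>q\<close> of
  \<open>s\<^sup>2 * u - a\<close> by \<open>2 ^ (m + 3)\<close> is odd, passing from
  \<open>s\<close> to \<open>s + 2 ^ (m + 2)\<close> adds the odd number \<open>s * u\<close> and an
  even number to it, so the quotient becomes even.\<close>

lemma exists_square_mult_cong:
  fixes u a :: int
  assumes "odd u" "[a = u] (mod 8)"
  shows "\<exists>s. odd s \<and> 2 ^ (m + 3) dvd s\<^sup>2 * u - a"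
proof (induction m)
  case 0
  then show ?case using assms(2) by (intro exI[of _ 1]) (simp add: cong_iff_dvd_diff dvd_diff_commute)
next
  case (Suc m)
  then obtain s q where s: "odd s" "s\<^sup>2 * u - a = 2 ^ (m + 3) * q" by (auto elim: dvdE)
  show ?case
  proof (cases "even q")
    case True
    then obtain p where "q = 2 * p" by (elim evenE)
    then have "s\<^sup>2 * u - a = 2 ^ (Suc m + 3) * p" using s(2) by (simp add: power_add)
    then show ?thesis using s(1) dvdI by blast
  next
    case False
    have "(s + 2 ^ (m + 2))\<^sup>2 * u - a = (s\<^sup>2 * u - a) + 2 ^ (m + 3) * (s * u + 2 ^ (m + 1) * u)"
      by (simp add: power2_eq_square power_add algebra_simps)
    also have "\<dots> = 2 ^ (m + 3) * (q + s * u + 2 ^ (m + 1) * u)"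
      unfolding s(2) by (simp add: algebra_simps)
    finally have eq: "(s + 2 ^ (m + 2))\<^sup>2 * u - a = 2 ^ (m + 3) * (q + s * u + 2 ^ (m + 1) * u)" .
    have "even (q + s * u + 2 ^ (m + 1) * u)" using False s(1) assms(1) by simp
    then obtain p where "q + s * u + 2 ^ (m + 1) * u = 2 * p" by (elim evenE)
    then have "(s + 2 ^ (m + 2))\<^sup>2 * u - a = 2 ^ (Suc m + 3) * p" using eq by (simp add: power_add)
    then have "2 ^ (Suc m + 3) dvd (s + 2 ^ (m + 2))\<^sup>2 * u - a" by (rule dvdI)
    then show ?thesis using s(1) by (intro exI[of _ "s + 2 ^ (m + 2)"]) simp
  qed
qed

section \<open>Discriminant modules generated along the first basis vector\<close>

context even_based_lattice
begin

text \<open>By \<open>dual\<close>, a dual vector is determined modulo the lattice by its first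
  coordinate, a multiple of \<open>1 / 2 ^ r\<close>. As \<open>s\<close> is a unit modulo
  \<open>2 ^ r\<close>, the vector \<open>w\<close> generates, and \<open>s\<close> adjusts its norm
  from \<open>u\<close> to \<open>a\<close>.\<close>

lemma isometric_A_module_first_basis_vector:
  fixes s u a :: int
  assumes r: "r \<ge> 1" and "odd a" "odd s" and s: "2 ^ (r + 1) dvd s\<^sup>2 * u - a" and n: "n > 0"
    and u: "form L (b 0) (b 0) = 2 ^ r * of_int u"
    and dvd: "\<And>j. j < n \<Longrightarrow> form L (b 0) (b j) / 2 ^ r \<in> \<int>"
    and dual: "\<And>t. dual t \<Longrightarrow> 2 ^ r * t 0 \<in> \<int> \<and> (\<forall>i<n. i \<noteq> 0 \<longrightarrow> t i \<in> \<int>)"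
  shows "isometrically_isomorphic (discriminant_module L) (A_module r a)"
proof -
  define w :: "nat \<Rightarrow> real" where "w i = (if i = 0 then of_int s / 2 ^ r else 0)" for i
  have sum_w: "(\<Sum>i<n. w i * f i) = of_int s / 2 ^ r * f 0" for f
  proof -
    have "(\<Sum>i<n. w i * f i) = (\<Sum>i<n. if i = 0 then of_int s / 2 ^ r * f 0 else 0)"
      by (rule sum.cong) (auto simp: w_def)
    then show ?thesis using n by simp
  qed
  have integral_iff: "integral (\<lambda>i. t i - of_int k * w i) \<longleftrightarrow> t 0 - of_int (k * s) / 2 ^ r \<in> \<int>"
    if "\<forall>i<n. i \<noteq> 0 \<longrightarrow> t i \<in> \<int>" for t and k :: int
    using that n by (force simp: integral_def w_def)
  have Ints_iff: "(of_int m :: real) / 2 ^ r \<in> \<int> \<longleftrightarrow> 2 ^ r dvd m" for m :: int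
    using of_int_div_of_int_in_Ints_iff[of m "2 ^ r", where 'a = real] by simp
  have coprime: "coprime s (2 ^ r)" using \<open>odd s\<close> by simp
  show ?thesis
  proof (rule isometric_A_moduleI[where w = w, OF r \<open>odd a\<close>])
    show "based_lattice.dual L n b w"
      unfolding dual_def
    proof (intro allI impI)
      fix j assume j: "j < n"
      have "of_int s * (form L (b 0) (b j) / 2 ^ r) \<in> \<int>" by (rule Ints_mult[OF Ints_of_int dvd[OF j]])
      then show "(\<Sum>i<n. w i * form L (b i) (b j)) \<in> \<int>" unfolding sum_w by simp
    qed
  next
    fix k :: int
    have "integral (\<lambda>i. of_int k * w i) \<longleftrightarrow> 2 ^ r dvd k * s"
      using integral_iff[of "\<lambda>i. 0" "- k"] Ints_iff[of "k * s"] by simp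
    then show "integral (\<lambda>i. of_int k * w i) \<longleftrightarrow> 2 ^ r dvd k"
      using coprime by (simp add: coprime_dvd_mult_left_iff coprime_commute)
  next
    fix t assume t: "based_lattice.dual L n b t"
    then obtain m where m: "2 ^ r * t 0 = of_int m" using dual by (meson Ints_cases)
    then have t0: "t 0 = of_int m / 2 ^ r" by (simp add: field_simps)
    \<comment> \<open>The multiplier is \<open>k = s' * m\<close> with \<open>s'\<close> inverse to
      \<open>s\<close>.\<close>
    obtain s' where "[s * s' = 1] (mod 2 ^ r)" using cong_solve_coprime_int[OF coprime] by blast
    then have "[s * s' * m = 1 * m] (mod 2 ^ r)" by (rule cong_scalar_right)
    then obtain k where "[s * k = m] (mod 2 ^ r)" by (simp add: mult.assoc)
    then have "2 ^ r dvd m - k * s" by (simp add: cong_iff_dvd_diff dvd_diff_commute mult.commute)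
    then have "t 0 - of_int (k * s) / 2 ^ r \<in> \<int>"
      using Ints_iff[of "m - k * s"] by (simp add: t0 diff_divide_distrib)
    then show "\<exists>k::int. integral (\<lambda>i. t i - of_int k * w i)"
      using integral_iff dual[OF t] by blast
  next
    have "bil w w = (\<Sum>i<n. w i * (\<Sum>j<n. w j * form L (b i) (b j)))"
      unfolding bil_def by (simp add: sum_distrib_left mult_ac)
    then have "bil w w / 2 = of_int (s\<^sup>2 * u) / 2 ^ (r + 1)"
      unfolding sum_w u by (simp add: power2_eq_square field_simps)
    then have "bil w w / 2 - of_int a / 2 ^ (r + 1) = of_int (s\<^sup>2 * u - a) / 2 ^ (r + 1)"
      by (simp add: diff_divide_distrib)
    also have "\<dots> \<in> \<int>"
      using s of_int_div_of_int_in_Ints_iff[of "s\<^sup>2 * u - a" "2 ^ (r + 1)", where 'a = real] by simp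
    finally show "bil w w / 2 - of_int a / 2 ^ (r + 1) \<in> \<int>" .
  qed
qed

end

text \<open>Here \<open>\<eta>\<close> is the sign of the form. The entry is a separate real
  \<open>c\<close>, so that literal entries such as \<open>2 ^ r\<close> and \<open>-2\<close> can
  be substituted.\<close>

lemma discriminant_rank_one:
  fixes s a \<eta> :: int and c :: real
  assumes "r \<ge> 1" "odd a" "odd s" "2 ^ (r + 1) dvd s\<^sup>2 * \<eta> - a" "\<eta>\<^sup>2 = 1" "c = of_int \<eta> * 2 ^ r"
  shows "even_nondegenerate_lattice (gram_lattice (mat_of_rows_list 1 [[c]])) \<and>
    isometrically_isomorphic (discriminant_module (gram_lattice (mat_of_rows_list 1 [[c]]))) (A_module r a)"
proof -
  define g :: "nat \<Rightarrow> nat \<Rightarrow> int" where "g i j = \<eta> * 2 ^ r" for i j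
  have "mat_of_rows_list 1 [[c]] = mat 1 1 (\<lambda>(i, j). of_int (g i j))"
    by (rule eq_matI) (auto simp: mat_of_rows_list_def g_def assms(6))
  moreover have "even_gram 1 g"
    using assms(1) by unfold_locales (auto simp: g_def)
  ultimately have G: "even_gram 1 g" and L: "gram_lattice (mat_of_rows_list 1 [[c]]) = gram_lattice (mat 1 1 (\<lambda>(i, j). of_int (g i j)))"
    by simp_all
  interpret even_gram 1 g "gram_lattice (mat 1 1 (\<lambda>(i, j). of_int (g i j)))"
    using G by simp_all
  have sq: "(of_int \<eta> :: real) * of_int \<eta> = 1"
    using assms(5) by (metis of_int_1 of_int_mult power2_eq_square)
  have form_0: "form (gram_lattice (mat 1 1 (\<lambda>(i, j). of_int (g i j)))) (unit_vec 1 0) (unit_vec 1 0) = 2 ^ r * of_int \<eta>"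
    by (subst form_unit_vec) (simp_all add: g_def)
  show ?thesis
    unfolding L
  proof
    show "even_nondegenerate_lattice (gram_lattice (mat 1 1 (\<lambda>(i, j). of_int (g i j))))"
      by (rule even_nondegenerate_L) (use sq in \<open>auto simp: g_def\<close>)
    show "isometrically_isomorphic (discriminant_module (gram_lattice (mat 1 1 (\<lambda>(i, j). of_int (g i j))))) (A_module r a)"
    proof (rule isometric_A_module_first_basis_vector[OF assms(1-4)])
      fix t assume "dual t"
      then have "t 0 * (2 ^ r * of_int \<eta>) \<in> \<int>"
        unfolding dual_def using form_0 by simp
      \<comment> \<open>The sign is its own inverse, so multiplying by it once more removes
        it.\<close>
      then have "of_int \<eta> * (t 0 * (2 ^ r * of_int \<eta>)) \<in> \<int>"
        by (intro Ints_mult[OF Ints_of_int])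
      then show "2 ^ r * t 0 \<in> \<int> \<and> (\<forall>i<1. i \<noteq> 0 \<longrightarrow> t i \<in> \<int>)"
        using sq by (simp add: mult_ac) (simp add: mult.assoc[symmetric])
    qed (use form_0 in auto)
  qed
qed


text \<open>The matrix of this system has determinant \<open>2 P \<eta>\<close>, and every entry of its adjugate except the first
  one is divisible by \<open>2 P\<close>.\<close>

lemma ternary_inverse:
  fixes P u v y \<delta> \<kappa> \<eta> t0 t1 t2 d0 d1 d2 :: real
  assumes "u * y = P * v\<^sup>2 + \<kappa>" "4 * \<delta> * \<kappa> - u = \<eta>" "\<eta>\<^sup>2 = 1"
    and "t0 * (2 * P * u) + t1 * (2 * P * v) = d0"
    and "t0 * (2 * P * v) + t1 * (2 * y) + t2 = d1"
    and "t1 + t2 * (2 * \<delta>) = d2"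
  shows "t1 = \<eta> * (- 2 * \<delta> * v * d0 + 2 * u * \<delta> * d1 - u * d2)"
    and "t2 = \<eta> * (v * d0 - u * d1 + 2 * \<kappa> * d2)"
    and "2 * P * t0 = \<eta> * ((4 * \<delta> * y - 1) * d0 - 4 * \<delta> * P * v * d1 + 2 * P * v * d2)"
proof -
  \<comment> \<open>With \<open>\<kappa>\<close>, \<open>\<eta>\<close> and the right-hand sides
    eliminated, the claims become polynomial identities: Cramer's rule, with \<open>2 * P\<close>
    cancelled for \<open>t1\<close> and \<open>t2\<close>.\<close>
  have \<kappa>: "\<kappa> = u * y - P * v\<^sup>2" and \<eta>: "\<eta> = 4 * \<delta> * \<kappa> - u" using assms(1,2) by simp_all
  have 1: "- 2 * \<delta> * v * d0 + 2 * u * \<delta> * d1 - u * d2 = \<eta> * t1"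
    unfolding assms(4-6)[symmetric] \<eta> \<kappa> by (simp add: power2_eq_square algebra_simps)
  have 2: "v * d0 - u * d1 + 2 * \<kappa> * d2 = \<eta> * t2"
    unfolding assms(4-6)[symmetric] \<eta> \<kappa> by (simp add: power2_eq_square algebra_simps)
  have 3: "(4 * \<delta> * y - 1) * d0 - 4 * \<delta> * P * v * d1 + 2 * P * v * d2 = \<eta> * (2 * P * t0)"
    unfolding assms(4-6)[symmetric] \<eta> \<kappa> by (simp add: power2_eq_square algebra_simps)
  have "\<eta> * (\<eta> * z) = z" for z
    using assms(3) by (simp add: power2_eq_square flip: mult.assoc)
  then show "t1 = \<eta> * (- 2 * \<delta> * v * d0 + 2 * u * \<delta> * d1 - u * d2)"
    and "t2 = \<eta> * (v * d0 - u * d1 + 2 * \<kappa> * d2)"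
    and "2 * P * t0 = \<eta> * ((4 * \<delta> * y - 1) * d0 - 4 * \<delta> * P * v * d1 + 2 * P * v * d2)"
    unfolding 1 2 3 by simp_all
qed

text \<open>A common form of both ternary matrices: \<open>u\<close>, \<open>\<delta>\<close>,
  \<open>\<kappa>\<close> will be \<open>5 * \<epsilon>\<close>, \<open>1\<close>,
  \<open>\<epsilon>\<close> or \<open>- 3 * \<epsilon>\<close>, \<open>- \<epsilon>\<close>,
  \<open>1\<close>, with \<open>\<eta> = - \<epsilon>\<close> in both cases.\<close>

lemma discriminant_rank_three:
  fixes s a u v y \<delta> \<kappa> \<eta> :: int and G :: "real mat"
  assumes r: "r \<ge> 1" "odd a" "odd s" "2 ^ (r + 1) dvd s\<^sup>2 * u - a"
    and eqs: "u * y = 2 ^ (r - 1) * v\<^sup>2 + \<kappa>" "4 * \<delta> * \<kappa> - u = \<eta>" "\<eta>\<^sup>2 = 1"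
    and G: "G = mat_of_rows_list 3
      [[of_int u * 2 ^ r, 2 ^ r * of_int v, 0],
       [2 ^ r * of_int v, of_int (2 * y), 1],
       [0, 1, of_int (2 * \<delta>)]]"
  shows "even_nondegenerate_lattice (gram_lattice G) \<and>
    isometrically_isomorphic (discriminant_module (gram_lattice G)) (A_module r a)"
proof -
  define g :: "nat \<Rightarrow> nat \<Rightarrow> int" where
    "g i j = [[u * 2 ^ r, 2 ^ r * v, 0], [2 ^ r * v, 2 * y, 1], [0, 1, 2 * \<delta>]] ! i ! j" for i j
  have g: "g 0 0 = u * 2 ^ r" "g 0 1 = 2 ^ r * v" "g 0 2 = 0" "g 1 0 = 2 ^ r * v" "g 1 1 = 2 * y"
    "g 1 2 = 1" "g 2 0 = 0" "g 2 1 = 1" "g 2 2 = 2 * \<delta>"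
    by (simp_all add: g_def)
  have less_3: "(i::nat) < 3 \<longleftrightarrow> i = 0 \<or> i = 1 \<or> i = 2" for i by auto
  have sum_3: "(\<Sum>i<3. f i) = f 0 + f 1 + f 2" for f :: "nat \<Rightarrow> real"
    by (simp add: numeral_3_eq_3 numeral_2_eq_2)
  have G_eq: "G = mat 3 3 (\<lambda>(i, j). of_int (g i j))"
    unfolding G by (rule eq_matI) (auto simp: mat_of_rows_list_def less_3 g_def)
  interpret even_gram 3 g "gram_lattice (mat 3 3 (\<lambda>(i, j). of_int (g i j)))"
    using r(1) by unfold_locales (auto simp: less_3 g simp del: One_nat_def)
  have pow: "(2::real) ^ r = 2 * 2 ^ (r - 1)" using r(1) by (cases r) auto
  have "(of_int (u * y) :: real) = of_int (2 ^ (r - 1) * v\<^sup>2 + \<kappa>)" "(of_int (4 * \<delta> * \<kappa> - u) :: real) = of_int \<eta>"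
    "(of_int (\<eta>\<^sup>2) :: real) = of_int 1"
    using eqs by simp_all
  then have R: "(of_int u :: real) * of_int y = 2 ^ (r - 1) * (of_int v)\<^sup>2 + of_int \<kappa>"
    "4 * (of_int \<delta> :: real) * of_int \<kappa> - of_int u = of_int \<eta>" "(of_int \<eta> :: real)\<^sup>2 = 1"
    by simp_all
  \<comment> \<open>The inverse formulas with \<open>P = 2 ^ (r - 1)\<close> serve twice:
    \<open>d = 0\<close> gives nondegeneracy, and integral \<open>d\<close> gives the shape of the
    dual lattice.\<close>
  have solve: "t 1 = of_int \<eta> * (- 2 * of_int \<delta> * of_int v * d 0 + 2 * of_int u * of_int \<delta> * d 1 - of_int u * d 2)"
      "t 2 = of_int \<eta> * (of_int v * d 0 - of_int u * d 1 + 2 * of_int \<kappa> * d 2)"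
      "2 ^ r * t 0 = of_int \<eta> * ((4 * of_int \<delta> * of_int y - 1) * d 0
          - 4 * of_int \<delta> * 2 ^ (r - 1) * of_int v * d 1 + 2 ^ r * of_int v * d 2)"
    if d: "\<And>j. d j = (\<Sum>i<3. t i * of_int (g i j))" for t d :: "nat \<Rightarrow> real"
  proof -
    have e: "t 0 * (2 * 2 ^ (r - 1) * of_int u) + t 1 * (2 * 2 ^ (r - 1) * of_int v) = d 0"
       "t 0 * (2 * 2 ^ (r - 1) * of_int v) + t 1 * (2 * of_int y) + t 2 = d 1"
       "t 1 + t 2 * (2 * of_int \<delta>) = d 2"
      unfolding d sum_3 g by (simp_all add: pow)
    from ternary_inverse[OF R e] show
      "t 1 = of_int \<eta> * (- 2 * of_int \<delta> * of_int v * d 0 + 2 * of_int u * of_int \<delta> * d 1 - of_int u * d 2)"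
      "t 2 = of_int \<eta> * (of_int v * d 0 - of_int u * d 1 + 2 * of_int \<kappa> * d 2)"
      "2 ^ r * t 0 = of_int \<eta> * ((4 * of_int \<delta> * of_int y - 1) * d 0
          - 4 * of_int \<delta> * 2 ^ (r - 1) * of_int v * d 1 + 2 ^ r * of_int v * d 2)"
      unfolding pow by (simp_all only:)
  qed
  show ?thesis
    unfolding G_eq
  proof
    show "even_nondegenerate_lattice (gram_lattice (mat 3 3 (\<lambda>(i, j). of_int (g i j))))"
    proof (rule even_nondegenerate_L)
      fix t :: "nat \<Rightarrow> real" assume t: "\<forall>j<3. (\<Sum>i<3. t i * of_int (g i j)) = 0"
      from solve[of "\<lambda>j. \<Sum>i<3. t i * of_int (g i j)" t] t show "\<forall>i<3. t i = 0"
        by (simp add: less_3 del: One_nat_def)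
    qed
    show "isometrically_isomorphic (discriminant_module (gram_lattice (mat 3 3 (\<lambda>(i, j). of_int (g i j))))) (A_module r a)"
    proof (rule isometric_A_module_first_basis_vector[OF r])
      fix t assume t: "dual t"
      define d :: "nat \<Rightarrow> real" where "d j = (\<Sum>i<3. t i * of_int (g i j))" for j
      have "d j \<in> \<int>" if "j < 3" for j
      proof -
        have "d j = (\<Sum>i<3. t i * form (gram_lattice (mat 3 3 (\<lambda>(i, j). of_int (g i j)))) (unit_vec 3 i) (unit_vec 3 j))"
          unfolding d_def using that by (intro sum.cong) (auto simp: form_unit_vec)
        then show ?thesis using t that unfolding dual_def by simp
      qed
      then have "d 0 \<in> \<int>" "d 1 \<in> \<int>" "d 2 \<in> \<int>" by simp_all
      moreover note solve[OF d_def]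
      ultimately have "2 ^ r * t 0 \<in> \<int>" "t 1 \<in> \<int>" "t 2 \<in> \<int>"
        by (simp_all only:) (intro Ints_mult Ints_add Ints_diff Ints_minus Ints_of_int Ints_power Ints_numeral Ints_1; assumption)+
      then show "2 ^ r * t 0 \<in> \<int> \<and> (\<forall>i<3. i \<noteq> 0 \<longrightarrow> t i \<in> \<int>)"
        by (simp add: less_3 del: One_nat_def)
    next
      fix j :: nat assume "j < 3"
      then show "form (gram_lattice (mat 3 3 (\<lambda>(i, j). of_int (g i j)))) (unit_vec 3 0) (unit_vec 3 j) / 2 ^ r \<in> \<int>"
        by (auto simp: form_unit_vec less_3 g simp del: One_nat_def)
    qed (auto simp: form_unit_vec g)
  qed
qed

section \<open>Lattices of rank less than three\<close>

lemma odd_square_cong_1: "odd s \<Longrightarrow> [s\<^sup>2 = 1] (mod 8)" for s :: int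
proof -
  assume "odd s"
  then obtain k where k: "s = 2 * k + 1" by (elim oddE)
  have "even (k * (k + 1))" by simp
  then obtain m where "k * (k + 1) = 2 * m" by (elim evenE)
  then have "s\<^sup>2 - 1 = 8 * m" unfolding k by (simp add: power2_eq_square algebra_simps)
  then show ?thesis by (simp add: cong_iff_dvd_diff)
qed

context even_based_lattice
begin

text \<open>In rank zero every vector is vacuously integral, so the generator would have order
  one.\<close>

lemma rank_pos_if_isometric:
  assumes "r \<ge> 1" "isometrically_isomorphic (discriminant_module L) (A_module r a)"
  shows "n \<noteq> 0"
proof
  assume "n = 0"
  then have "integral t" for t unfolding integral_def by simp
  moreover obtain w where "\<And>k::int. integral (\<lambda>i. of_int k * w i) \<longleftrightarrow> 2 ^ r dvd k"
    using isometric_A_moduleD[OF assms] by blast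
  ultimately have "(2::int) ^ r dvd 1" by blast
  with assms(1) show False by simp
qed

text \<open>Comparing the order of the generator with the Gram entry \<open>m\<close> gives
  \<open>m = \<eta> * 2 ^ r\<close> for a sign \<open>\<eta>\<close>. With \<open>s\<close> the
  integer \<open>w 0 * m\<close>, half the norm of \<open>w\<close> is
  \<open>\<eta> * s\<^sup>2 / 2 ^ (r + 1)\<close>, so \<open>a\<close> is \<open>\<eta>\<close>
  times an odd square modulo 8.\<close>

lemma rank_one_isometric_imp:
  assumes r: "r \<ge> 2" and "odd a" and n: "n = 1"
    and iso: "isometrically_isomorphic (discriminant_module L) (A_module r a)"
  shows "[a = 1] (mod 8) \<or> [a = -1] (mod 8)"
proof -
  obtain m :: int where m: "form L (b 0) (b 0) = of_int m"
    using form_b_Ints[of 0 0] n by (auto elim: Ints_cases)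
  have int_n: "integral t \<longleftrightarrow> t 0 \<in> \<int>" for t unfolding integral_def using n by simp
  have dual_n: "dual t \<longleftrightarrow> t 0 * of_int m \<in> \<int>" for t unfolding dual_def using n m by simp
  obtain w where w: "dual w" and order: "\<And>k::int. integral (\<lambda>i. of_int k * w i) \<longleftrightarrow> 2 ^ r dvd k"
    and gen: "\<And>t. dual t \<Longrightarrow> \<exists>k::int. integral (\<lambda>i. t i - of_int k * w i)"
    and q: "bil w w / 2 - of_int a / 2 ^ (r + 1) \<in> \<int>"
    using isometric_A_moduleD[OF _ iso] r by auto
  have bil: "bil w w = w 0 * w 0 * of_int m" unfolding bil_def using n m by simp
  obtain s :: int where s: "w 0 * of_int m = of_int s" using w unfolding dual_n by (auto elim: Ints_cases)
  have div: "(of_int x :: real) / 2 ^ (r + 1) \<in> \<int> \<longleftrightarrow> 2 ^ (r + 1) dvd x" for x :: int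
    using of_int_div_of_int_in_Ints_iff[of x "2 ^ (r + 1)", where 'a = real] by simp
  have "m \<noteq> 0"
  proof
    assume "m = 0"
    then have "of_int a / 2 ^ (r + 1) \<in> (\<int> :: real set)" using q bil by (metis Ints_minus diff_0 div_0 minus_minus mult_zero_right of_int_0)
    then have "2 ^ (r + 1) dvd a" by (simp only: div)
    then have "2 dvd a" by (metis Suc_eq_plus1 dvd_mult_left power_Suc)
    with \<open>odd a\<close> show False by simp
  qed
  \<comment> \<open>The multiple of \<open>w\<close> by \<open>m\<close> is the integer
    \<open>s\<close>, so the order of \<open>w\<close> divides \<open>m\<close>.\<close>
  have "2 ^ r dvd m"
    using order[of m] s by (simp add: int_n mult.commute)
  moreover have "m dvd 2 ^ r"
  proof -
    \<comment> \<open>The vector \<open>1 / m\<close> is a multiple of \<open>w\<close> modulo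
      integers; multiplying by \<open>2 ^ r\<close> makes the multiple of \<open>w\<close> integral
      and leaves \<open>2 ^ r / m\<close> integral.\<close>
    have "dual (\<lambda>_. 1 / of_int m)" using \<open>m \<noteq> 0\<close> by (simp add: dual_n)
    from gen[OF this] obtain k :: int where "1 / of_int m - of_int k * w 0 \<in> \<int>"
      unfolding int_n by blast
    then have "2 ^ r * (1 / of_int m - of_int k * w 0) \<in> \<int>" by (intro Ints_mult Ints_power) auto
    moreover have "of_int k * (of_int (2 ^ r) * w 0) \<in> \<int>"
      using order[of "2 ^ r"] unfolding int_n by (blast intro: Ints_mult Ints_of_int dvd_refl)
    ultimately have "2 ^ r * (1 / of_int m - of_int k * w 0) + of_int k * (of_int (2 ^ r) * w 0) \<in> \<int>"
      by (rule Ints_add)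
    then have "of_int (2 ^ r) / (of_int m :: real) \<in> \<int>" by (simp add: algebra_simps)
    then show ?thesis
      using \<open>m \<noteq> 0\<close> of_int_div_of_int_in_Ints_iff[of "2 ^ r" m, where 'a = real] by blast
  qed
  ultimately have "\<bar>m\<bar> = \<bar>2 ^ r\<bar>" by (metis abs_dvd_iff dvd_abs_iff zdvd_antisym_abs)
  then have "m = 1 * 2 ^ r \<or> m = - 1 * 2 ^ r" by auto
  then obtain \<eta> :: int where \<eta>: "m = \<eta> * 2 ^ r" "\<eta> = 1 \<or> \<eta> = -1" by blast
  have "w 0 = of_int \<eta> * of_int s / 2 ^ r"
    using s \<eta> by (auto simp: field_simps)
  then have half_bil: "bil w w / 2 = of_int (\<eta> * s\<^sup>2) / 2 ^ (r + 1)"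
    unfolding bil using \<eta> by (auto simp: field_simps power2_eq_square)
  have "of_int (\<eta> * s\<^sup>2 - a) / 2 ^ (r + 1) \<in> (\<int> :: real set)"
    using q unfolding half_bil by (simp only: of_int_diff diff_divide_distrib)
  then have dvd: "2 ^ (r + 1) dvd \<eta> * s\<^sup>2 - a" by (simp only: div)
  \<comment> \<open>The bound \<open>r \<ge> 2\<close> is what makes 8 divide the modulus.\<close>
  have "(2::int) ^ 3 dvd 2 ^ (r + 1)" by (rule le_imp_power_dvd) (use r in simp)
  from dvd_trans[OF this dvd] have 8: "8 dvd \<eta> * s\<^sup>2 - a" by simp
  have "(2::int) dvd 8" by simp
  from dvd_trans[OF this 8] have "even (\<eta> * s\<^sup>2 - a)" .
  then have "odd s" using \<open>odd a\<close> \<eta>(2) by auto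
  from odd_square_cong_1[OF this] have "[\<eta> * s\<^sup>2 = \<eta> * 1] (mod 8)" by (rule cong_scalar_left)
  moreover have "[a = \<eta> * s\<^sup>2] (mod 8)" using 8 by (simp add: cong_iff_dvd_diff dvd_diff_commute)
  ultimately have "[a = \<eta> * 1] (mod 8)" by (rule cong_trans[rotated])
  with \<eta>(2) show ?thesis by auto
qed

text \<open>In rank two the off-diagonal entry of the Gram matrix decides the 2-torsion of the discriminant
  group: it is trivial if the entry is odd, and contains \<open>(\<int>/2)\<^sup>2\<close> if the entry is even.\<close>

lemma rank_two_not_isometric:
  assumes r: "r \<ge> 1" and n: "n = 2"
  shows "\<not> isometrically_isomorphic (discriminant_module L) (A_module r a)"
proof
  assume iso: "isometrically_isomorphic (discriminant_module L) (A_module r a)"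
  have sum_2: "(\<Sum>i<n. f i) = f 0 + f 1" for f :: "nat \<Rightarrow> real"
    unfolding n by (simp add: numeral_2_eq_2)
  have all_2: "(\<forall>i<n. Q i) \<longleftrightarrow> Q 0 \<and> Q 1" for Q
    unfolding n by (auto simp: less_2_cases_iff)
  obtain p q :: int where pq: "form L (b 0) (b 0) = 2 * of_int p" "form L (b 1) (b 1) = 2 * of_int q"
    using even b_closed[of 0] b_closed[of 1] n unfolding even_form_def by (metis one_less_numeral_iff pos2 semiring_norm(76))
  obtain g :: int where g: "form L (b 0) (b 1) = of_int g" "form L (b 1) (b 0) = of_int g"
    using form_b_Ints[of 0 1] form_b_commute[of 0 1] n by (auto elim: Ints_cases)
  have int_n: "integral t \<longleftrightarrow> t 0 \<in> \<int> \<and> t 1 \<in> \<int>" for t by (simp add: integral_def all_2)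
  have dual_n: "dual t \<longleftrightarrow> t 0 * (2 * of_int p) + t 1 * of_int g \<in> \<int> \<and>
      t 0 * of_int g + t 1 * (2 * of_int q) \<in> \<int>" for t
    unfolding dual_def all_2 sum_2 pq g by simp
  obtain w where w: "dual w" and order: "\<And>k::int. integral (\<lambda>i. of_int k * w i) \<longleftrightarrow> 2 ^ r dvd k"
    and gen: "\<And>t. dual t \<Longrightarrow> \<exists>k::int. integral (\<lambda>i. t i - of_int k * w i)"
    using isometric_A_moduleD[OF r iso] by blast
  have pow: "(2::int) ^ r = 2 * 2 ^ (r - 1)" using r by (cases r) auto
  have half: "(of_int x :: real) / 2 \<in> \<int> \<longleftrightarrow> even x" for x :: int
    using of_int_div_of_int_in_Ints_iff[of x 2, where 'a = real] by simp
  show False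
  proof (cases "even g")
    case True
    then obtain g' where g': "g = 2 * g'" by (elim evenE)
    \<comment> \<open>In a cyclic group generated by \<open>w\<close>, a class of order two is an
      odd multiple of \<open>2 ^ (r - 1)\<close> times \<open>w\<close>; any two such multiples
      agree.\<close>
    have torsion: "\<exists>m. odd m \<and> integral (\<lambda>i. t i - of_int (2 ^ (r - 1) * m) * w i)"
      if t: "dual t" "integral (\<lambda>i. 2 * t i)" "\<not> integral t" for t
    proof -
      obtain k where k: "integral (\<lambda>i. t i - of_int k * w i)" using gen[OF t(1)] by blast
      have "integral (\<lambda>i. of_int (2 * k) * w i)"
        using integral_diff[OF t(2) integral_of_int_mult[OF k, of 2]] by (simp add: algebra_simps)
      then have "2 ^ r dvd 2 * k" using order by blast
      then have "2 ^ (r - 1) dvd k" unfolding pow by simp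
      then obtain m where m: "k = 2 ^ (r - 1) * m" by (elim dvdE)
      have "odd m"
      proof
        assume "even m"
        then have "2 ^ r dvd k" unfolding pow m by (simp add: mult.commute)
        then have "integral (\<lambda>i. of_int k * w i)" using order by blast
        from integral_add[OF k this] t(3) show False by simp
      qed
      with k m show ?thesis by blast
    qed
    \<comment> \<open>Half of each basis vector is dual because all Gram entries are even, and the
      two halves lie in different classes.\<close>
    define t where "t = (\<lambda>i::nat. if i = 0 then 1 / 2 else 0 :: real)"
    define t' where "t' = (\<lambda>i::nat. if i = 1 then 1 / 2 else 0 :: real)"
    have half_not: "(1 / 2 :: real) \<notin> \<int>" using half[of 1] by simp
    obtain m where m: "odd m" "integral (\<lambda>i. t i - of_int (2 ^ (r - 1) * m) * w i)"
      using torsion[of t] half_not by (auto simp: dual_n int_n t_def g')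
    obtain m' where m': "odd m'" "integral (\<lambda>i. t' i - of_int (2 ^ (r - 1) * m') * w i)"
      using torsion[of t'] half_not by (auto simp: dual_n int_n t'_def g')
    have "2 ^ r dvd 2 ^ (r - 1) * m - 2 ^ (r - 1) * m'"
      unfolding pow right_diff_distrib[symmetric] using m(1) m'(1) by (simp add: mult.commute)
    then have "integral (\<lambda>i. of_int (2 ^ (r - 1) * m - 2 ^ (r - 1) * m') * w i)" using order by blast
    from integral_add[OF integral_diff[OF m(2) m'(2)] this]
    have "integral (\<lambda>i. t i - t' i)" by (simp add: algebra_simps)
    then show False using half_not by (simp add: int_n t_def t'_def)
  next
    case False
    \<comment> \<open>The class of order two. Its double is integral, and duality with
      \<open>g\<close> odd will make both numerators even, so that \<open>y\<close> itself is
      integral.\<close>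
    define y where "y = (\<lambda>i. of_int (2 ^ (r - 1)) * w i)"
    have "dual y" unfolding y_def by (rule dual_of_int_mult[OF w])
    have "integral (\<lambda>i. of_int (2 ^ r) * w i)" using order[of "2 ^ r"] dvd_refl by blast
    then have "integral (\<lambda>i. 2 * y i)" unfolding y_def pow by (simp add: mult.assoc)
    then obtain z0 z1 :: int where z: "2 * y 0 = of_int z0" "2 * y 1 = of_int z1"
      unfolding int_n by (auto elim!: Ints_cases)
    then have y: "y 0 = of_int z0 / 2" "y 1 = of_int z1 / 2" by simp_all
    have "of_int (2 * z0 * p + z1 * g) / (2::real) \<in> \<int>" "of_int (z0 * g + 2 * z1 * q) / (2::real) \<in> \<int>"
      using \<open>dual y\<close> unfolding dual_n y by (simp_all add: add_divide_distrib mult_ac)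
    then have "even z0" "even z1" unfolding half using False by simp_all
    then have "integral y" unfolding int_n y half by simp
    then have "2 ^ r dvd (2::int) ^ (r - 1)" unfolding y_def using order by blast
    then show False unfolding pow by (simp add: dvd_mult_cancel2)
  qed
qed

end

text \<open>Ranks zero and two are excluded for every \<open>a\<close>, and rank one forces
  \<open>a\<close> to be 1 or -1 modulo 8, whereas the residues in question are 5 and 3.\<close>

lemma no_small_rank_isometric:
  fixes L :: "'l bilinear_module"
  assumes "r > 1" "odd a" "[a = \<epsilon> * 5] (mod 8)" "\<epsilon> = 1 \<or> \<epsilon> = -1"
    and "even_nondegenerate_lattice L" "free_of_rank L n" "n < 3"
  shows "\<not> isometrically_isomorphic (discriminant_module L) (A_module r a)"
proof
  assume iso: "isometrically_isomorphic (discriminant_module L) (A_module r a)"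
  obtain b where "int_basis L n b" using assms(6) by (auto simp: free_of_rank_def)
  then interpret even_based_lattice L n b
    using assms(5) by unfold_locales (simp_all add: even_nondegenerate_lattice_def)
  have r: "r \<ge> 1" "r \<ge> 2" using assms(1) by simp_all
  have "n \<noteq> 0" by (rule rank_pos_if_isometric[OF r(1) iso])
  moreover have "n \<noteq> 2" using rank_two_not_isometric[OF r(1)] iso by blast
  ultimately have "n = 1" using assms(7) by simp
  from rank_one_isometric_imp[OF r(2) assms(2) this iso]
  have "[\<epsilon> * 5 = 1] (mod 8) \<or> [\<epsilon> * 5 = -1] (mod 8)"
    using assms(3) cong_sym cong_trans by blast
  with assms(4) show False by (auto simp: cong_def)
qed

section \<open>Assembly of the four families of lattices\<close>

theorem theorem4p5:
  fixes r :: nat and a :: int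
  assumes "r > 1" and "odd a"
  shows
    "(\<comment> \<open>part (1)\<close>
      ([a = 1] (mod 8) \<longrightarrow>
        (let L = gram_lattice (mat_of_rows_list 1 [[2 ^ r]]) in
          even_nondegenerate_lattice L \<and>
          isometrically_isomorphic (discriminant_module L) (A_module r a))) \<and>
      ([a = -1] (mod 8) \<longrightarrow>
        (let L = gram_lattice (mat_of_rows_list 1 [[- (2 ^ r)]]) in
          even_nondegenerate_lattice L \<and>
          isometrically_isomorphic (discriminant_module L) (A_module r a)))) \<and>
     (\<comment> \<open>part (2)\<close>
      \<forall>(\<epsilon>::int) (v::int) (x::real).
        \<epsilon> \<in> {1, -1} \<and> [a = \<epsilon> * 5] (mod 8) \<and> odd r \<and>
        [2 ^ (r - 1) * v\<^sup>2 = - \<epsilon>] (mod 5) \<and>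
        x = (2 ^ (r - 1) * (of_int v)\<^sup>2 + of_int \<epsilon>) / 5 \<longrightarrow>
        (let L = gram_lattice (mat_of_rows_list 3
               [[of_int \<epsilon> * 5 * 2 ^ r, 2 ^ r * of_int v,     0],
                [2 ^ r * of_int v,     of_int \<epsilon> * (2 * x), 1],
                [0,                    1,                   2]]) in
          even_nondegenerate_lattice L \<and>
          isometrically_isomorphic (discriminant_module L) (A_module r a)) \<and>
        \<not> (\<exists>(L'::'l bilinear_module) n.
             even_nondegenerate_lattice L' \<and> free_of_rank L' n \<and> n < 3 \<and>
             isometrically_isomorphic (discriminant_module L') (A_module r a))) \<and>
     (\<comment> \<open>part (3)\<close>
      \<forall>(\<epsilon>::int) (v::int) (x::real).
        \<epsilon> \<in> {1, -1} \<and> [a = \<epsilon> * 5] (mod 8) \<and> even r \<and>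
        [2 ^ (r - 1) * v\<^sup>2 = - 1] (mod 3) \<and>
        x = (2 ^ (r - 1) * (of_int v)\<^sup>2 + 1) / 3 \<longrightarrow>
        (let L = gram_lattice (mat_of_rows_list 3
               [[- of_int \<epsilon> * 3 * 2 ^ r, 2 ^ r * of_int v,       0],
                [2 ^ r * of_int v,       - of_int \<epsilon> * (2 * x), 1],
                [0,                      1,                     - of_int \<epsilon> * 2]]) in
          even_nondegenerate_lattice L \<and>
          isometrically_isomorphic (discriminant_module L) (A_module r a)) \<and>
        \<not> (\<exists>(L'::'l bilinear_module) n.
             even_nondegenerate_lattice L' \<and> free_of_rank L' n \<and> n < 3 \<and>
             isometrically_isomorphic (discriminant_module L') (A_module r a))) \<and>
     (\<comment> \<open>part (4)\<close>
      ([a = 1] (mod 4) \<longrightarrow>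
        (let L = gram_lattice (mat_of_rows_list 1 [[2]]) in
          even_nondegenerate_lattice L \<and>
          isometrically_isomorphic (discriminant_module L) (A_module 1 a))) \<and>
      ([a = -1] (mod 4) \<longrightarrow>
        (let L = gram_lattice (mat_of_rows_list 1 [[-2]]) in
          even_nondegenerate_lattice L \<and>
          isometrically_isomorphic (discriminant_module L) (A_module 1 a))))"
proof -
  \<comment> \<open>The lifting index is \<open>r - 2\<close>, because the modulus
    \<open>2 ^ (m + 3)\<close> has to be \<open>2 ^ (r + 1)\<close>.\<close>
  have square: "\<exists>s. odd s \<and> 2 ^ (r + 1) dvd s\<^sup>2 * u - a" if "odd u" "[a = u] (mod 8)" for u
    using exists_square_mult_cong[OF that, of "r - 2"] assms(1) by simp
  have r: "r \<ge> 1" using assms(1) by simp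
  have rank_one: "even_nondegenerate_lattice (gram_lattice (mat_of_rows_list 1 [[c]])) \<and>
      isometrically_isomorphic (discriminant_module (gram_lattice (mat_of_rows_list 1 [[c]]))) (A_module r a)"
    if \<eta>: "[a = \<eta>] (mod 8)" "\<eta> = 1 \<or> \<eta> = -1" "c = of_int \<eta> * 2 ^ r" for c :: real and \<eta>
  proof -
    obtain s where "odd s" "2 ^ (r + 1) dvd s\<^sup>2 * \<eta> - a" using square[of \<eta>] \<eta>(1,2) by auto
    then show ?thesis using \<eta> by (intro discriminant_rank_one[OF r assms(2)]) auto
  qed
  \<comment> \<open>For \<open>r = 1\<close> the modulus \<open>2 ^ (r + 1)\<close> is 4, so the
    choice \<open>s = 1\<close> suffices.\<close>
  have rank_one_4: "even_nondegenerate_lattice (gram_lattice (mat_of_rows_list 1 [[c]])) \<and>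
      isometrically_isomorphic (discriminant_module (gram_lattice (mat_of_rows_list 1 [[c]]))) (A_module 1 a)"
    if "[a = \<eta>] (mod 4)" "\<eta> = 1 \<or> \<eta> = -1" "c = of_int \<eta> * 2" for c :: real and \<eta>
    using that
    by (intro discriminant_rank_one[where s = 1 and \<eta> = \<eta>])
      (auto simp: assms(2) cong_iff_dvd_diff dvd_diff_commute)
  have rank_three: "even_nondegenerate_lattice (gram_lattice G) \<and>
      isometrically_isomorphic (discriminant_module (gram_lattice G)) (A_module r a)"
    if u: "[a = u] (mod 8)" "odd u" "u * y = 2 ^ (r - 1) * v\<^sup>2 + \<kappa>" "4 * \<delta> * \<kappa> - u = \<eta>" "\<eta>\<^sup>2 = 1"
      "G = mat_of_rows_list 3
        [[of_int u * 2 ^ r, 2 ^ r * of_int v, 0], [2 ^ r * of_int v, of_int (2 * y), 1], [0, 1, of_int (2 * \<delta>)]]"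
    for u v y \<delta> \<kappa> \<eta> :: int and G :: "real mat"
  proof -
    obtain s where "odd s" "2 ^ (r + 1) dvd s\<^sup>2 * u - a" using square[OF u(2,1)] by blast
    from discriminant_rank_three[OF r assms(2) this u(3-6)] show ?thesis .
  qed
  have part2: "even_nondegenerate_lattice (gram_lattice G) \<and>
      isometrically_isomorphic (discriminant_module (gram_lattice G)) (A_module r a)"
    if \<epsilon>: "\<epsilon> = 1 \<or> \<epsilon> = -1" and a: "[a = \<epsilon> * 5] (mod 8)" and v: "[2 ^ (r - 1) * v\<^sup>2 = - \<epsilon>] (mod 5)"
      and x: "x = (2 ^ (r - 1) * (of_int v)\<^sup>2 + of_int \<epsilon>) / 5"
      and G: "G = mat_of_rows_list 3
               [[of_int \<epsilon> * 5 * 2 ^ r, 2 ^ r * of_int v,     0],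
                [2 ^ r * of_int v,     of_int \<epsilon> * (2 * x), 1],
                [0,                    1,                   2]]" for \<epsilon> v :: int and x :: real and G
  proof -
    \<comment> \<open>The congruence on \<open>v\<close> says that \<open>x\<close> is an integer,
      here called \<open>X\<close>; the parameter \<open>y\<close> of the ternary form is then
      \<open>\<epsilon> * X\<close>.\<close>
    obtain X where X: "2 ^ (r - 1) * v\<^sup>2 + \<epsilon> = 5 * X"
      using v by (auto simp: cong_iff_dvd_diff elim: dvdE)
    then have "(of_int (2 ^ (r - 1) * v\<^sup>2 + \<epsilon>) :: real) = of_int (5 * X)" by (simp only:)
    then have "x = of_int X" unfolding x by simp
    then have G': "G = mat_of_rows_list 3
        [[of_int (5 * \<epsilon>) * 2 ^ r, 2 ^ r * of_int v, 0], [2 ^ r * of_int v, of_int (2 * (\<epsilon> * X)), 1],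
         [0, 1, of_int (2 * 1)]]"
      unfolding G by (simp add: mult_ac)
    show ?thesis
    proof (rule rank_three[OF _ _ _ _ _ G'])
      show "5 * \<epsilon> * (\<epsilon> * X) = 2 ^ (r - 1) * v\<^sup>2 + \<epsilon>" unfolding X using \<epsilon> by auto
      show "4 * 1 * \<epsilon> - 5 * \<epsilon> = - \<epsilon>" by simp
    qed (use \<epsilon> a in \<open>auto simp: mult.commute\<close>)
  qed
  have part3: "even_nondegenerate_lattice (gram_lattice G) \<and>
      isometrically_isomorphic (discriminant_module (gram_lattice G)) (A_module r a)"
    if \<epsilon>: "\<epsilon> = 1 \<or> \<epsilon> = -1" and a: "[a = \<epsilon> * 5] (mod 8)" and v: "[2 ^ (r - 1) * v\<^sup>2 = - 1] (mod 3)"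
      and x: "x = (2 ^ (r - 1) * (of_int v)\<^sup>2 + 1) / 3"
      and G: "G = mat_of_rows_list 3
               [[- of_int \<epsilon> * 3 * 2 ^ r, 2 ^ r * of_int v,       0],
                [2 ^ r * of_int v,       - of_int \<epsilon> * (2 * x), 1],
                [0,                      1,                     - of_int \<epsilon> * 2]]"
    for \<epsilon> v :: int and x :: real and G
  proof -
    obtain X where X: "2 ^ (r - 1) * v\<^sup>2 + 1 = 3 * X"
      using v by (auto simp: cong_iff_dvd_diff elim: dvdE)
    then have "(of_int (2 ^ (r - 1) * v\<^sup>2 + 1) :: real) = of_int (3 * X)" by (simp only:)
    then have "x = of_int X" unfolding x by simp
    then have G': "G = mat_of_rows_list 3
        [[of_int (- 3 * \<epsilon>) * 2 ^ r, 2 ^ r * of_int v, 0], [2 ^ r * of_int v, of_int (2 * (- \<epsilon> * X)), 1],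
         [0, 1, of_int (2 * (- \<epsilon>))]]"
      unfolding G by (simp add: mult_ac)
    show ?thesis
    proof (rule rank_three[OF _ _ _ _ _ G'])
      show "- 3 * \<epsilon> * (- \<epsilon> * X) = 2 ^ (r - 1) * v\<^sup>2 + 1" unfolding X using \<epsilon> by auto
      show "4 * (- \<epsilon>) * 1 - - 3 * \<epsilon> = - \<epsilon>" by simp
      \<comment> \<open>The two residues differ by \<open>8 * \<epsilon>\<close>.\<close>
      have "[\<epsilon> * 5 = - 3 * \<epsilon>] (mod 8)" by (simp add: cong_iff_dvd_diff)
      with a show "[a = - 3 * \<epsilon>] (mod 8)" by (rule cong_trans)
    qed (use \<epsilon> in auto)
  qed
  show ?thesis
    unfolding Let_def
  \<comment> \<open>Each lattice yields two goals, one for the lattice and one for the isometry;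
    cases 7 and 10 are the minimality of the rank.\<close>
  proof (intro conjI allI impI, goal_cases)
    case 1
    then show ?case using rank_one[of 1 "2 ^ r"] by simp
  next
    case 2
    then show ?case using rank_one[of 1 "2 ^ r"] by simp
  next
    case 3
    then show ?case using rank_one[of "-1" "- (2 ^ r)"] by simp
  next
    case 4
    then show ?case using rank_one[of "-1" "- (2 ^ r)"] by simp
  next
    case (5 \<epsilon> v x)
    then show ?case using part2[OF _ _ _ _ refl, of \<epsilon> v x] by blast
  next
    case (6 \<epsilon> v x)
    then show ?case using part2[OF _ _ _ _ refl, of \<epsilon> v x] by blast
  next
    case (7 \<epsilon> v x)
    then show ?case using no_small_rank_isometric[OF assms, of \<epsilon>] by blast
  next
    case (8 \<epsilon> v x)
    then show ?case using part3[OF _ _ _ _ refl, of \<epsilon> v x] by blast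
  next
    case (9 \<epsilon> v x)
    then show ?case using part3[OF _ _ _ _ refl, of \<epsilon> v x] by blast
  next
    case (10 \<epsilon> v x)
    then show ?case using no_small_rank_isometric[OF assms, of \<epsilon>] by blast
  next
    case 11
    then show ?case using rank_one_4[of 1 2] by simp
  next
    case 12
    then show ?case using rank_one_4[of 1 2] by simp
  next
    case 13
    then show ?case using rank_one_4[of "-1" "-2"] by simp
  next
    case 14
    then show ?case using rank_one_4[of "-1" "-2"] by simp
  qed
qed

end
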